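(* Let $G$ be a simple graph on $n$ vertices which is neither the complete graph $K_n$ nor the empty graph (the graph with no edges). (i) If $G$ or its complement $\overline{G}$ is a disjoint union of complete graphs, $r$ of which have the maximum number of vertices among the components, then $\mathrm{Rep}(G) = n-\max\{r,2\}$. (ii) Otherwise, let $m_1$ and $m_2$ denote the multiplicities of the smallest and the second smallest distinct eigenvalue of the adjacency matrix $A(G)$, and let $\overline{m_1}$ and $\overline{m_2}$ denote the corresponding multiplicities for the adjacency matrix of $\overline{G}$. Then \[ n-1-\max\{m_1,\overline{m_1},m_2+1,\overline{m_2}+1\} \;\leq\; \mathrm{Rep}(G) \;\leq\; n-\max\{m_1,\overline{m_1},2\}. \] Moreover, in this case, if $G$ is regular, then $\mathrm{Rep}(G) = n-1-\max\{m_1,\overline{m_1}\}$.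
   Context: A simple graph $G$ is representable in $\mathbb{R}^m$ if there is a map from the vertex set of $G$ into $\mathbb{R}^m$ and distinct positive constants $\alpha\neq\beta$ such that for all distinct vertices $u,v$, the Euclidean distance between the images of $u$ and $v$ is $\alpha$ if $u$ and $v$ are adjacent and $\beta$ otherwise. The Euclidean representation number $\mathrm{Rep}(G)$ is the smallest $m$ such that $G$ is representable in $\mathbb{R}^m$. A graph is regular if all vertices have the same degree. *)

theory Defs
  imports "HOL-Analysis.Analysis"
begin

text \<open>
  A graph is given by its adjacency relation on a finite vertex type, so that its adjacency
  matrix is an element of \<open>real^'v^'v\<close>.
\<close>

type_synonym 'v graph = "'v \<Rightarrow> 'v \<Rightarrow> bool"

definition simple_graph :: "'v graph \<Rightarrow> bool" where
  "simple_graph G \<longleftrightarrow> symp G \<and> irreflp G"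

definition complement_graph :: "'v graph \<Rightarrow> 'v graph" where
  "complement_graph G = (\<lambda>u v. u \<noteq> v \<and> \<not> G u v)"

definition complete_graph :: "'v graph \<Rightarrow> bool" where
  "complete_graph G \<longleftrightarrow> (\<forall>u v. u \<noteq> v \<longrightarrow> G u v)"

definition empty_graph :: "'v graph \<Rightarrow> bool" where
  "empty_graph G \<longleftrightarrow> (\<forall>u v. \<not> G u v)"

definition vertex_degree :: "'v::finite graph \<Rightarrow> 'v \<Rightarrow> nat" where
  "vertex_degree G u = card {v. G u v}"

definition regular :: "'v::finite graph \<Rightarrow> bool" where
  "regular G \<longleftrightarrow> (\<forall>u v. vertex_degree G u = vertex_degree G v)"

definition connected_components :: "'v graph \<Rightarrow> 'v set set" where
  "connected_components G = (\<Union>u. {{v. G\<^sup>*\<^sup>* u v}})"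

definition disjoint_union_of_complete :: "'v graph \<Rightarrow> bool" where
  "disjoint_union_of_complete G \<longleftrightarrow>
     (\<forall>C\<in>connected_components G. \<forall>u\<in>C. \<forall>v\<in>C. u \<noteq> v \<longrightarrow> G u v)"

definition num_max_components :: "'v::finite graph \<Rightarrow> nat" where
  "num_max_components G =
     card {C \<in> connected_components G. card C = Max (card ` connected_components G)}"

text \<open>
  Since \<open>m\<close> varies, points of \<open>\<real>\<^sup>m\<close> are functions \<open>nat \<Rightarrow> real\<close> of which only the
  coordinates below \<open>m\<close> matter.
\<close>

definition euclidean_dist :: "nat \<Rightarrow> (nat \<Rightarrow> real) \<Rightarrow> (nat \<Rightarrow> real) \<Rightarrow> real" where
  "euclidean_dist m x y = L2_set (\<lambda>i. x i - y i) {..<m}"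

definition representable :: "'v graph \<Rightarrow> nat \<Rightarrow> bool" where
  "representable G m \<longleftrightarrow>
     (\<exists>(f :: 'v \<Rightarrow> nat \<Rightarrow> real) \<alpha> \<beta>. 0 < \<alpha> \<and> 0 < \<beta> \<and> \<alpha> \<noteq> \<beta> \<and>
        (\<forall>u v. u \<noteq> v \<longrightarrow> euclidean_dist m (f u) (f v) = (if G u v then \<alpha> else \<beta>)))"

definition Rep :: "'v graph \<Rightarrow> nat" where
  "Rep G = (LEAST m. representable G m)"

definition adjacency_matrix :: "'v::finite graph \<Rightarrow> real^'v^'v" where
  "adjacency_matrix G = (\<chi> u v. if G u v then 1 else 0)"

definition eigenvalues :: "real^'n^'n \<Rightarrow> real set" where
  "eigenvalues A = {l. \<exists>x. x \<noteq> 0 \<and> A *v x = l *\<^sub>R x}"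

text \<open>
  Multiplicity is the dimension of the eigenspace. It is applied to symmetric real matrices only,
  for which it agrees with the multiplicity as a root of the characteristic polynomial.
\<close>

definition eigenvalue_multiplicity :: "real^'n^'n \<Rightarrow> real \<Rightarrow> nat" where
  "eigenvalue_multiplicity A l = dim {x. A *v x = l *\<^sub>R x}"

definition smallest_eigenvalue :: "real^'n^'n \<Rightarrow> real" where
  "smallest_eigenvalue A = Min (eigenvalues A)"

definition second_smallest_eigenvalue :: "real^'n^'n \<Rightarrow> real" where
  "second_smallest_eigenvalue A = Min (eigenvalues A - {smallest_eigenvalue A})"

end

theory Submission
  imports Defs
begin

text \<open>
  With squared distances \<open>a\<close> (edges) and \<open>b\<close> (non-edges), a map of the vertices into
  \<open>\<real>\<^sup>m\<close> with these distances exists iff the form \<open>b |x|\<^sup>2 + (b - a) (x \<bullet> A x)\<close> is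
  nonnegative of rank at most \<open>m\<close> on the space of vectors of sum zero. For \<open>a < b\<close> the rank drops
  below \<open>n - 1\<close> for just one ratio \<open>b / (b - a)\<close>, namely when it is minus the least Rayleigh
  quotient of \<open>A\<close> on that space, and this ratio exceeds 1 (that is, \<open>a > 0\<close>) iff \<open>G\<close> has an
  induced path on three vertices, iff \<open>G\<close> is not a disjoint union of complete graphs. The case
  \<open>b < a\<close> is the same for the complement. So \<open>Rep G\<close> is \<open>n - 1\<close> minus the larger of the two
  dimensions of the spaces of minimizers. Passing from the whole space to a hyperplane interlaces
  eigenvalues, which bounds these dimensions in terms of the multiplicities; for regular graphs the
  hyperplane is invariant, and for disjoint unions of complete graphs the eigenvectors are constant
  on the components.
\<close>

section \<open>Quadratic forms and Rayleigh quotients\<close>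

locale self_adjoint =
  fixes T :: "'a::euclidean_space \<Rightarrow> 'a"
  assumes linear: "linear T"
    and sym: "x \<bullet> T y = T x \<bullet> y"
begin

lemma sym': "x \<bullet> T y = y \<bullet> T x"
  by (metis inner_commute sym)

lemma shift: "self_adjoint (\<lambda>x. T x - c *\<^sub>R x)"
proof (rule self_adjoint.intro)
  show "linear (\<lambda>x. T x - c *\<^sub>R x)"
    by (intro linear_compose_sub linear linear_compose_scale_right linear_ident)
qed (simp add: inner_diff_left inner_diff_right sym)

lemma form_add_scaled:
  "(x + c *\<^sub>R y) \<bullet> T (x + c *\<^sub>R y) = x \<bullet> T x + 2 * c * (y \<bullet> T x) + c\<^sup>2 * (y \<bullet> T y)"
proof -
  have "x \<bullet> T y = y \<bullet> T x" by (rule sym')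
  then show ?thesis
    by (simp add: linear_add[OF linear] linear_scale[OF linear] inner_add_left inner_add_right
        algebra_simps power2_eq_square)
qed

text \<open>Along the line \<open>x + c y\<close> the form equals \<open>2 c p + c^2 q\<close> with
  mixed term \<open>p\<close>. A nonzero \<open>p\<close> would make it negative for small
  \<open>c\<close> of the opposite sign.\<close>

lemma nonneg_form_zero_imp_orthogonal:
  assumes "subspace U" and nonneg: "\<And>x. x \<in> U \<Longrightarrow> 0 \<le> x \<bullet> T x"
    and "x \<in> U" "y \<in> U" "x \<bullet> T x = 0"
  shows "y \<bullet> T x = 0"
proof (rule ccontr)
  assume ne: "y \<bullet> T x \<noteq> 0"
  define p q where "p = y \<bullet> T x" and "q = y \<bullet> T y"
  have q: "0 \<le> q" using nonneg[OF \<open>y \<in> U\<close>] by (simp add: q_def)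
  \<comment> \<open>The natural choice is the minimizer \<open>- p / q\<close>; the denominator
    \<open>q + 1\<close> also covers \<open>q = 0\<close>.\<close>
  define c where "c = - p / (q + 1)"
  have "x + c *\<^sub>R y \<in> U"
    using assms by (simp add: subspace_add subspace_scale)
  then have "0 \<le> 2 * c * p + c\<^sup>2 * q"
    using nonneg[of "x + c *\<^sub>R y"] form_add_scaled[of x c y] assms(5) by (simp add: p_def q_def)
  also have "2 * c * p + c\<^sup>2 * q = - (p\<^sup>2 * (q + 2) / (q + 1)\<^sup>2)"
    using q unfolding c_def by (simp add: divide_simps power2_eq_square) algebra
  finally have "p\<^sup>2 * (q + 2) / (q + 1)\<^sup>2 \<le> 0" by simp
  moreover have "0 < p\<^sup>2 * (q + 2) / (q + 1)\<^sup>2"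
    using q ne by (intro divide_pos_pos mult_pos_pos) (auto simp: p_def)
  ultimately show False by simp
qed

text \<open>Null vectors pair to zero with all of \<open>U\<close>, so the cross term in the form of
  a sum of two of them vanishes.\<close>

lemma subspace_form_zero:
  assumes "subspace U" and nonneg: "\<And>x. x \<in> U \<Longrightarrow> 0 \<le> x \<bullet> T x"
  shows "subspace {x \<in> U. x \<bullet> T x = 0}"
proof (rule subspaceI)
  show "0 \<in> {x \<in> U. x \<bullet> T x = 0}" using assms by (simp add: subspace_0)
next
  fix x y assume xy: "x \<in> {x \<in> U. x \<bullet> T x = 0}" "y \<in> {x \<in> U. x \<bullet> T x = 0}"
  then have "y \<bullet> T x = 0" using nonneg_form_zero_imp_orthogonal[OF assms] by simp
  then show "x + y \<in> {x \<in> U. x \<bullet> T x = 0}"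
    using xy form_add_scaled[of x 1 y] assms(1) by (simp add: subspace_add)
next
  fix c x assume "x \<in> {x \<in> U. x \<bullet> T x = 0}"
  then show "c *\<^sub>R x \<in> {x \<in> U. x \<bullet> T x = 0}"
    using assms(1) by (simp add: subspace_scale linear_scale[OF linear])
qed

end

text \<open>Lagrange's reduction: subtracting the square of \<open>x \<mapsto> B(u,x)/\<surd>B(u,u)\<close> enlarges the null space.\<close>

lemma nonneg_form_sum_of_squares:
  fixes T :: "'a::euclidean_space \<Rightarrow> 'a"
  assumes "self_adjoint T" and U: "subspace U"
    and "\<And>x. x \<in> U \<Longrightarrow> 0 \<le> x \<bullet> T x"
    and "dim U \<le> dim {x \<in> U. x \<bullet> T x = 0} + m"
  shows "\<exists>g :: nat \<Rightarrow> 'a. \<forall>x\<in>U. x \<bullet> T x = (\<Sum>i<m. (g i \<bullet> x)\<^sup>2)"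
  using assms(1,3,4)
proof (induction m arbitrary: T)
  case 0
  interpret self_adjoint T by fact
  have "{x \<in> U. x \<bullet> T x = 0} = U"
    using 0 by (intro subspace_dim_equal subspace_form_zero U) auto
  then show ?case by auto
next
  case (Suc m)
  interpret self_adjoint T by fact
  let ?N = "\<lambda>S :: 'a \<Rightarrow> 'a. {x \<in> U. x \<bullet> S x = 0}"
  show ?case
  proof (cases "\<forall>x\<in>U. x \<bullet> T x = 0")
    case True
    then show ?thesis by (intro exI[of _ "\<lambda>_. 0"]) simp
  next
    case False
    then obtain u where u: "u \<in> U" and upos: "0 < u \<bullet> T u"
      using Suc.prems(2) by fastforce
    define S where "S = (\<lambda>x. T x - ((x \<bullet> T u) / (u \<bullet> T u)) *\<^sub>R T u)"
    have form: "x \<bullet> S x = x \<bullet> T x - (x \<bullet> T u)\<^sup>2 / (u \<bullet> T u)" for x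
      by (simp add: S_def inner_diff_right power2_eq_square)
    have "self_adjoint S"
    proof (rule self_adjoint.intro)
      show "linear S" unfolding S_def
        by (rule linearI)
          (simp_all add: linear_add[OF linear] linear_scale[OF linear] algebra_simps
            inner_add_left add_divide_distrib)
      show "x \<bullet> S y = S x \<bullet> y" for x y
        by (simp add: S_def inner_diff_left inner_diff_right sym[of x y] inner_commute[of "T u" y])
    qed
    have nonneg: "0 \<le> x \<bullet> S x" if "x \<in> U" for x
    proof -
      \<comment> \<open>\<open>?c\<close> removes the part of \<open>x\<close> along
        \<open>u\<close> with respect to the form of \<open>T\<close>. At the remaining vector that
        form takes the value of the form of \<open>S\<close> at \<open>x\<close>.\<close>
      let ?c = "- (u \<bullet> T x) / (u \<bullet> T u)"
      have "x + ?c *\<^sub>R u \<in> U" using that u U by (simp only: subspace_add subspace_scale)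
      then have "0 \<le> x \<bullet> T x + 2 * ?c * (u \<bullet> T x) + ?c\<^sup>2 * (u \<bullet> T u)"
        using Suc.prems(2) form_add_scaled[of x ?c u] by metis
      also have "\<dots> = x \<bullet> S x"
        using upos sym'[of x u] unfolding form by (simp add: field_simps power2_eq_square)
      finally show ?thesis .
    qed
    \<comment> \<open>The vector \<open>u\<close> joins the null space and no old null vector leaves
      it. Its dimension therefore grows, and \<open>m\<close> squares suffice for
      \<open>S\<close>.\<close>
    have sub: "insert u (?N T) \<subseteq> ?N S"
    proof
      fix x assume x: "x \<in> insert u (?N T)"
      show "x \<in> ?N S"
      proof (cases "x = u")
        case True
        then show ?thesis using u upos by (simp add: form power2_eq_square)
      next
        case False
        then have "x \<in> U" "x \<bullet> T x = 0" using x by auto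
        moreover from this have "u \<bullet> T x = 0"
          using nonneg_form_zero_imp_orthogonal[OF U Suc.prems(2)] u by blast
        ultimately show ?thesis using sym'[of x u] by (simp add: form)
      qed
    qed
    have "span (?N T) = ?N T"
      using subspace_form_zero[OF U Suc.prems(2)] by (simp add: span_eq_iff)
    then have "u \<notin> span (?N T)" using upos by (metis (mono_tags, lifting) mem_Collect_eq less_irrefl)
    then have "dim (?N T) + 1 = dim (insert u (?N T))" by (simp add: dim_insert)
    also have "\<dots> \<le> dim (?N S)" by (rule dim_subset[OF sub])
    finally have "dim U \<le> dim (?N S) + m" using Suc.prems(3) by simp
    then obtain g :: "nat \<Rightarrow> 'a" where g: "\<forall>x\<in>U. x \<bullet> S x = (\<Sum>i<m. (g i \<bullet> x)\<^sup>2)"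
      using Suc.IH[OF \<open>self_adjoint S\<close> nonneg] by blast
    \<comment> \<open>The additional functional is the one whose square was subtracted to form
      \<open>S\<close>.\<close>
    let ?g = "g(m := (1 / sqrt (u \<bullet> T u)) *\<^sub>R T u)"
    have "x \<bullet> T x = (\<Sum>i<Suc m. (?g i \<bullet> x)\<^sup>2)" if "x \<in> U" for x
    proof -
      have "(\<Sum>i<Suc m. (?g i \<bullet> x)\<^sup>2) = (\<Sum>i<m. (g i \<bullet> x)\<^sup>2) + (x \<bullet> T u)\<^sup>2 / (u \<bullet> T u)"
        using upos by (simp add: power_divide inner_commute)
      then show ?thesis using form[of x] bspec[OF g that] by linarith
    qed
    then show ?thesis by blast
  qed
qed

text \<open>A lower bound attained at a nonzero vector: this form avoids quotients and infima, and
  it determines \<open>l\<close> uniquely.\<close>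

definition rayleigh_min :: "('a::euclidean_space \<Rightarrow> 'a) \<Rightarrow> 'a set \<Rightarrow> real \<Rightarrow> bool" where
  "rayleigh_min T U l \<longleftrightarrow>
     (\<forall>x\<in>U. l * (x \<bullet> x) \<le> x \<bullet> T x) \<and> (\<exists>x\<in>U. x \<noteq> 0 \<and> x \<bullet> T x = l * (x \<bullet> x))"

definition rayleigh_space :: "('a::euclidean_space \<Rightarrow> 'a) \<Rightarrow> 'a set \<Rightarrow> real \<Rightarrow> 'a set" where
  "rayleigh_space T U l = {x \<in> U. x \<bullet> T x = l * (x \<bullet> x)}"

lemma rayleigh_min_le: "rayleigh_min T U l \<Longrightarrow> x \<in> U \<Longrightarrow> l * (x \<bullet> x) \<le> x \<bullet> T x"
  by (simp add: rayleigh_min_def)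

lemma rayleigh_min_mono:
  assumes "rayleigh_min T U l" and "x \<in> U" "x \<noteq> 0" "x \<bullet> T x \<le> k * (x \<bullet> x)"
  shows "l \<le> k"
proof -
  have "l * (x \<bullet> x) \<le> k * (x \<bullet> x)" using assms(4) rayleigh_min_le[OF assms(1,2)] by linarith
  then show ?thesis using assms(3) by simp
qed

lemma rayleigh_min_antimono:
  assumes "rayleigh_min T U l" "rayleigh_min T V k" "V \<subseteq> U"
  shows "l \<le> k"
proof -
  obtain x where "x \<in> V" "x \<noteq> 0" "x \<bullet> T x = k * (x \<bullet> x)"
    using assms(2) by (auto simp: rayleigh_min_def)
  then show ?thesis using rayleigh_min_mono[OF assms(1), of x k] assms(3) by auto
qed

lemma rayleigh_min_unique:
  "rayleigh_min T U l \<Longrightarrow> rayleigh_min T U k \<Longrightarrow> l = k"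
  by (meson antisym rayleigh_min_antimono subset_refl)

context self_adjoint
begin

text \<open>The form attains its minimum on the compact unit sphere of \<open>U\<close>, and
  homogeneity carries the bound to all of \<open>U\<close>.\<close>

lemma rayleigh_min_exists:
  assumes U: "subspace U" and "U \<noteq> {0}"
  obtains l where "rayleigh_min T U l"
proof -
  let ?S = "U \<inter> sphere 0 1"
  obtain w where w: "w \<in> U" "w \<noteq> 0" using assms subspace_0 by blast
  then have "(1 / norm w) *\<^sub>R w \<in> ?S" using U by (simp add: subspace_scale)
  moreover have "compact ?S"
    using U by (simp add: closed_Int_compact closed_subspace)
  moreover have "continuous_on ?S (\<lambda>x. x \<bullet> T x)"
    by (intro continuous_intros linear_continuous_on linear_conv_bounded_linear[THEN iffD1] linear)
  ultimately obtain z where z: "z \<in> ?S" and min: "\<forall>y\<in>?S. z \<bullet> T z \<le> y \<bullet> T y"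
    using continuous_attains_inf[of ?S] by blast
  have zz: "z \<bullet> z = 1" using z by (simp add: dot_square_norm)
  have "(z \<bullet> T z) * (x \<bullet> x) \<le> x \<bullet> T x" if x: "x \<in> U" for x
  proof (cases "x = 0")
    case False
    define y where "y = (1 / norm x) *\<^sub>R x"
    have "y \<in> ?S" using U x False by (simp add: y_def subspace_scale)
    then have "z \<bullet> T z \<le> y \<bullet> T y" using min by blast
    also have "y \<bullet> T y = (x \<bullet> T x) / (x \<bullet> x)"
      by (simp add: y_def linear_scale[OF linear] dot_square_norm power2_eq_square)
    finally show ?thesis using False by (simp add: field_simps)
  qed simp
  moreover have "z \<in> U" "z \<noteq> 0" "z \<bullet> T z = (z \<bullet> T z) * (z \<bullet> z)" using z zz by auto
  ultimately have "rayleigh_min T U (z \<bullet> T z)"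
    unfolding rayleigh_min_def by blast
  then show ?thesis by (rule that)
qed

text \<open>After a shift by \<open>l\<close> the form is nonnegative on \<open>U\<close> and the
  minimizers are its null vectors, which pair to zero with all of \<open>U\<close>. So the
  minimizers are eigenvectors of the compression of \<open>T\<close> to \<open>U\<close>.\<close>

lemma rayleigh_space_iff:
  assumes "subspace U" "rayleigh_min T U l"
  shows "x \<in> rayleigh_space T U l \<longleftrightarrow> x \<in> U \<and> (\<forall>y\<in>U. y \<bullet> T x = l * (y \<bullet> x))"
proof -
  interpret S: self_adjoint "\<lambda>x. T x - l *\<^sub>R x" by (rule shift)
  have nonneg: "0 \<le> x \<bullet> (T x - l *\<^sub>R x)" if "x \<in> U" for x
    using rayleigh_min_le[OF assms(2) that] by (simp add: inner_diff_right)
  show ?thesis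
    using S.nonneg_form_zero_imp_orthogonal[OF assms(1) nonneg, of x]
    by (auto simp: rayleigh_space_def inner_diff_right)
qed

lemma subspace_rayleigh_space:
  assumes "subspace U" "rayleigh_min T U l"
  shows "subspace (rayleigh_space T U l)"
proof -
  interpret S: self_adjoint "\<lambda>x. T x - l *\<^sub>R x" by (rule shift)
  have "rayleigh_space T U l = {x \<in> U. x \<bullet> (T x - l *\<^sub>R x) = 0}"
    by (simp add: rayleigh_space_def inner_diff_right)
  then show ?thesis
    using S.subspace_form_zero[OF assms(1)] rayleigh_min_le[OF assms(2)]
    by (simp add: inner_diff_right)
qed

text \<open>If \<open>T\<close> preserves \<open>U\<close>, then \<open>T x - l x\<close> lies in
  \<open>U\<close> and is also orthogonal to \<open>U\<close>, so it vanishes.\<close>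

lemma rayleigh_space_invariant:
  assumes "subspace U" "rayleigh_min T U l" "T ` U \<subseteq> U"
  shows "rayleigh_space T U l = {x \<in> U. T x = l *\<^sub>R x}"
proof -
  have "T x = l *\<^sub>R x" if x: "x \<in> rayleigh_space T U l" for x
  proof -
    let ?d = "T x - l *\<^sub>R x"
    have *: "x \<in> U" "\<forall>y\<in>U. y \<bullet> T x = l * (y \<bullet> x)"
      using x rayleigh_space_iff[OF assms(1,2)] by auto
    then have "?d \<in> U" using assms(3) by (intro subspace_diff subspace_scale assms(1)) auto
    then have "?d \<bullet> ?d = 0" using * by (simp add: inner_diff_right)
    then show ?thesis by simp
  qed
  moreover have "x \<in> rayleigh_space T U l" if "x \<in> U" "T x = l *\<^sub>R x" for x
    using that by (simp add: rayleigh_space_def)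
  moreover have "rayleigh_space T U l \<subseteq> U" by (auto simp: rayleigh_space_def)
  ultimately show ?thesis by blast
qed

lemma eigenvectors_orthogonal:
  assumes "T x = l *\<^sub>R x" "T y = k *\<^sub>R y" "l \<noteq> k"
  shows "x \<bullet> y = 0"
proof -
  have "l * (x \<bullet> y) = k * (x \<bullet> y)" using sym[of x y] unfolding assms(1,2) by auto
  then show ?thesis using assms(3) by auto
qed

end

section \<open>Gram forms of representations\<close>

definition zero_sum :: "(real^'n) set" where
  "zero_sum = {x. (\<Sum>v\<in>UNIV. x $ v) = 0}"

lemma zero_sum_eq: "zero_sum = {x. vec 1 \<bullet> x = 0}"
  by (simp add: zero_sum_def inner_vec_def)

lemma subspace_zero_sum: "subspace zero_sum"
  unfolding zero_sum_eq by (rule subspace_hyperplane)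

section \<open>Dimensions of hyperplane sections\<close>

lemma dim_Int_hyperplane:
  fixes S :: "'a::euclidean_space set"
  assumes "subspace S"
  shows "dim S \<le> dim {x \<in> S. a \<bullet> x = 0} + 1"
proof (cases "{x \<in> S. a \<bullet> x = 0} = S")
  case False
  then obtain s where s: "s \<in> S" "a \<bullet> s \<noteq> 0" by auto
  let ?H = "{x \<in> S. a \<bullet> x = 0}"
  have "S \<subseteq> span (insert s ?H)"
  proof
    fix x assume x: "x \<in> S"
    let ?c = "(a \<bullet> x) / (a \<bullet> s)"
    have "x - ?c *\<^sub>R s \<in> ?H"
      using x s assms by (simp add: subspace_diff subspace_scale inner_diff_right)
    then show "x \<in> span (insert s ?H)" by (auto intro: span_base simp: span_insert)
  qed
  then have "dim S \<le> dim (insert s ?H)" by (rule dim_mono)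
  then show ?thesis by (auto simp: dim_insert split: if_splits)
qed simp

text \<open>Each vector of \<open>W\<close> costs at most one dimension. The use is with the
  coordinate vectors of a representation.\<close>

lemma dim_orthogonal_to_finite:
  fixes W :: "'a::euclidean_space set"
  assumes "finite W"
  shows "DIM('a) \<le> dim {x. \<forall>w\<in>W. w \<bullet> x = 0} + card W"
  using assms
proof (induction W rule: finite_induct)
  case (insert w W)
  let ?S = "{x. \<forall>w\<in>W. w \<bullet> x = 0}"
  have "subspace ?S" by (intro subspaceI) (auto simp: inner_add_right)
  then have "dim ?S \<le> dim {x \<in> ?S. w \<bullet> x = 0} + 1" by (rule dim_Int_hyperplane)
  moreover have "{x \<in> ?S. w \<bullet> x = 0} = {x. \<forall>w\<in>insert w W. w \<bullet> x = 0}" by auto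
  ultimately show ?case using insert by simp
qed simp

lemma dim_Int_hyperplane_eq:
  fixes S :: "'a::euclidean_space set"
  assumes "subspace S" "s \<in> S" "a \<bullet> s \<noteq> 0"
  shows "dim S = dim {x \<in> S. a \<bullet> x = 0} + 1"
proof -
  let ?H = "{x \<in> S. a \<bullet> x = 0}"
  have "subspace ?H" using assms(1)
    by (auto simp: subspace_def inner_add_right)
  then have "s \<notin> span ?H" using assms(3) by (simp add: span_eq_iff[THEN iffD2])
  then have "dim ?H + 1 = dim (insert s ?H)" by (simp add: dim_insert)
  also have "\<dots> \<le> dim S" using assms(2) by (intro dim_subset) auto
  finally show ?thesis using dim_Int_hyperplane[OF assms(1), of a] by simp
qed

lemma dim_zero_sum: "dim (zero_sum :: (real^'n) set) + 1 = CARD('n)"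
proof -
  have "dim (UNIV :: (real^'n) set) = dim {x \<in> UNIV. (vec 1 :: real^'n) \<bullet> x = 0} + 1"
    by (rule dim_Int_hyperplane_eq[of _ "vec 1"]) (simp_all add: inner_vec_def)
  then show ?thesis by (simp add: zero_sum_eq)
qed

lemma zero_sum_axis_diff: "axis u c - axis v c \<in> zero_sum"
  by (simp add: zero_sum_def axis_def sum_subtractf)

section \<open>Adjacency matrices of a graph and its complement\<close>

lemma transpose_adjacency_matrix:
  "simple_graph G \<Longrightarrow> transpose (adjacency_matrix G) = adjacency_matrix G"
  by (auto simp: transpose_def adjacency_matrix_def vec_eq_iff simple_graph_def dest: sympD)

lemma self_adjoint_adjacency_matrix:
  assumes "simple_graph G"
  shows "self_adjoint ((*v) (adjacency_matrix G))"
proof (rule self_adjoint.intro)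
  show "linear ((*v) (adjacency_matrix G))" by (rule matrix_vector_mul_linear)
  show "x \<bullet> (adjacency_matrix G *v y) = (adjacency_matrix G *v x) \<bullet> y" for x y
    by (metis assms dot_lmul_matrix transpose_adjacency_matrix vector_transpose_matrix)
qed

lemma adjacency_matrix_mult_nth:
  "(adjacency_matrix G *v x) $ u = (\<Sum>v\<in>UNIV. if G u v then x $ v else 0)"
  by (auto simp: matrix_vector_mult_def adjacency_matrix_def intro!: sum.cong)

lemma simple_complement_graph: "simple_graph G \<Longrightarrow> simple_graph (complement_graph G)"
  by (auto simp: simple_graph_def complement_graph_def symp_def irreflp_def)

lemma complement_complement_graph:
  "simple_graph G \<Longrightarrow> complement_graph (complement_graph G) = G"
  by (auto simp: simple_graph_def complement_graph_def irreflp_def fun_eq_iff)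

text \<open>The identity and the two adjacency matrices add up to the all-ones matrix, which
  annihilates vectors of sum zero.\<close>

lemma adjacency_complement_graph:
  assumes "simple_graph G" "x \<in> zero_sum"
  shows "adjacency_matrix (complement_graph G) *v x = - x - adjacency_matrix G *v x"
proof -
  have "(adjacency_matrix (complement_graph G) *v x) $ u =
      (- x - adjacency_matrix G *v x) $ u" for u
  proof -
    have "(if complement_graph G u v then x $ v else 0) + (if u = v then x $ v else 0)
        + (if G u v then x $ v else 0) = x $ v" for v
      using assms(1) by (auto simp: complement_graph_def simple_graph_def irreflp_def)
    then have "(\<Sum>v\<in>UNIV. (if complement_graph G u v then x $ v else 0)
        + (if u = v then x $ v else 0) + (if G u v then x $ v else 0)) = (\<Sum>v\<in>UNIV. x $ v)"
      by simp
    then show ?thesis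
      using assms(2) by (simp add: sum.distrib adjacency_matrix_mult_nth zero_sum_def)
  qed
  then show ?thesis by (simp add: vec_eq_iff)
qed

text \<open>
  For squared distances \<open>a\<close> and \<open>b\<close>, twice the quadratic form of the Gram matrix of a centred
  representation of \<open>G\<close>, restricted to coefficient vectors of sum zero.
\<close>

definition gram_form :: "'v::finite graph \<Rightarrow> real \<Rightarrow> real \<Rightarrow> real^'v \<Rightarrow> real" where
  "gram_form G a b x = b * (x \<bullet> x) + (b - a) * (x \<bullet> (adjacency_matrix G *v x))"

lemma euclidean_dist_square: "(euclidean_dist m x y)\<^sup>2 = (\<Sum>i<m. (x i - y i)\<^sup>2)"
  by (simp add: euclidean_dist_def L2_set_def sum_nonneg)

text \<open>When the square is expanded, both pure terms carry the factor \<open>sum w S\<close>,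
  which is zero; only the mixed term survives.\<close>

lemma sum_weighted_square_differences:
  fixes w h :: "'a \<Rightarrow> real"
  assumes "sum w S = 0"
  shows "(\<Sum>u\<in>S. \<Sum>v\<in>S. w u * w v * (h u - h v)\<^sup>2) = - 2 * (\<Sum>v\<in>S. w v * h v)\<^sup>2"
proof -
  have "(\<Sum>u\<in>S. \<Sum>v\<in>S. w u * w v * (h u - h v)\<^sup>2)
      = (\<Sum>u\<in>S. \<Sum>v\<in>S. (w u * (h u)\<^sup>2) * w v + w u * (w v * (h v)\<^sup>2)
          - 2 * ((w u * h u) * (w v * h v)))"
    by (intro sum.cong refl) (simp add: power2_eq_square algebra_simps)
  also have "\<dots> = (\<Sum>u\<in>S. w u * (h u)\<^sup>2) * sum w S + sum w S * (\<Sum>v\<in>S. w v * (h v)\<^sup>2)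
      - 2 * ((\<Sum>u\<in>S. w u * h u) * (\<Sum>v\<in>S. w v * h v))"
    unfolding sum_product sum_distrib_left[of "2::real"] by (simp add: sum.distrib sum_subtractf)
  finally show ?thesis using assms by (simp add: power2_eq_square)
qed

lemma gram_form_eq_sum_of_squares:
  assumes "simple_graph G" and x: "x \<in> zero_sum"
    and dist: "\<And>u v. u \<noteq> v \<Longrightarrow> (euclidean_dist m (f u) (f v))\<^sup>2 = (if G u v then a else b)"
  shows "gram_form G a b x = 2 * (\<Sum>i<m. ((\<chi> v. f v i) \<bullet> x)\<^sup>2)"
proof -
  have irr: "\<not> G u u" for u using assms(1) by (simp add: simple_graph_def irreflp_def)
  have "- 2 * (\<Sum>i<m. ((\<chi> v. f v i) \<bullet> x)\<^sup>2)
      = (\<Sum>i<m. \<Sum>u\<in>UNIV. \<Sum>v\<in>UNIV. x $ u * x $ v * (f u i - f v i)\<^sup>2)"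
    using x by (subst sum_weighted_square_differences)
      (simp_all add: zero_sum_def inner_vec_def sum_distrib_left mult.commute)
  also have "\<dots> = (\<Sum>u\<in>UNIV. \<Sum>v\<in>UNIV. x $ u * x $ v * (euclidean_dist m (f u) (f v))\<^sup>2)"
    unfolding euclidean_dist_square sum_distrib_left
    by (subst sum.swap, intro sum.cong refl, subst sum.swap, rule refl)
  \<comment> \<open>The squared distance is \<open>b\<close> everywhere, corrected by
    \<open>- b\<close> on the diagonal and by \<open>a - b\<close> on edges. The constant part drops
    out because \<open>x\<close> has sum zero.\<close>
  also have "\<dots> = (\<Sum>u\<in>UNIV. \<Sum>v\<in>UNIV. b * (x $ u * x $ v)
      - b * (if u = v then x $ u * x $ v else 0)
      + (a - b) * (x $ u * (if G u v then x $ v else 0)))"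
  proof (intro sum.cong refl)
    fix u v
    show "x $ u * x $ v * (euclidean_dist m (f u) (f v))\<^sup>2 = b * (x $ u * x $ v)
      - b * (if u = v then x $ u * x $ v else 0)
      + (a - b) * (x $ u * (if G u v then x $ v else 0))"
    proof (cases "u = v")
      case True
      then show ?thesis using irr by (simp add: euclidean_dist_square)
    next
      case False
      then show ?thesis using dist by (simp add: algebra_simps)
    qed
  qed
  also have "\<dots> = b * ((\<Sum>u\<in>UNIV. x $ u) * (\<Sum>v\<in>UNIV. x $ v)) - b * (x \<bullet> x)
      + (a - b) * (x \<bullet> (adjacency_matrix G *v x))"
    by (simp add: sum.distrib sum_subtractf sum_distrib_left[symmetric] sum_distrib_right[symmetric]
        inner_vec_def adjacency_matrix_mult_nth)
  also have "\<dots> = - gram_form G a b x"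
    using x by (simp add: gram_form_def zero_sum_def algebra_simps)
  finally show ?thesis by simp
qed

text \<open>This recovers the prescribed squared distances, up to the factor 2, when points are
  built from the form.\<close>

lemma gram_form_axis_diff:
  assumes "simple_graph G" "u \<noteq> v"
  shows "gram_form G a b (axis u 1 - axis v 1) = 2 * (if G u v then a else b)"
proof -
  have G: "\<not> G u u" "\<not> G v v" "G v u = G u v"
    using assms(1) by (auto simp: simple_graph_def irreflp_def dest: sympD)
  have *: "(adjacency_matrix G *v axis w 1) $ t = (if G t w then 1 else 0)" for w t
    by (simp add: matrix_vector_mult_basis column_def adjacency_matrix_def)
  have "(axis u 1 - axis v 1) \<bullet> (adjacency_matrix G *v (axis u 1 - axis v 1))
      = - 2 * (if G u v then 1 else 0 :: real)"
    using G by (simp add: matrix_vector_mult_diff_distrib inner_diff_left inner_axis' *)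
  moreover have "(axis u 1 - axis v 1) \<bullet> (axis u 1 - axis v (1::real)) = 2"
    using assms(2) by (simp add: inner_diff_left inner_axis' inner_axis) (simp add: axis_def)
  ultimately show ?thesis by (simp add: gram_form_def)
qed

text \<open>A representation writes the form as \<open>m\<close> squares, one per coordinate;
  conversely, the functionals of such a decomposition serve as coordinates. The \<open>+ 1\<close>
  appears because \<open>zero_sum\<close> has codimension one.\<close>

lemma representable_iff_gram_form:
  fixes G :: "'v::finite graph"
  assumes G: "simple_graph G"
  shows "representable G m \<longleftrightarrow> (\<exists>a b. 0 < a \<and> 0 < b \<and> a \<noteq> b \<and>
      (\<forall>x\<in>zero_sum. 0 \<le> gram_form G a b x) \<and>
      CARD('v) \<le> dim {x \<in> zero_sum. gram_form G a b x = 0} + m + 1)"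
proof
  assume "representable G m"
  then obtain f :: "'v \<Rightarrow> nat \<Rightarrow> real" and \<alpha> \<beta> where pos: "0 < \<alpha>" "0 < \<beta>" "\<alpha> \<noteq> \<beta>"
    and d: "\<And>u v. u \<noteq> v \<Longrightarrow> euclidean_dist m (f u) (f v) = (if G u v then \<alpha> else \<beta>)"
    unfolding representable_def by blast
  have form: "gram_form G (\<alpha>\<^sup>2) (\<beta>\<^sup>2) x = 2 * (\<Sum>i<m. ((\<chi> v. f v i) \<bullet> x)\<^sup>2)" if "x \<in> zero_sum" for x
    by (rule gram_form_eq_sum_of_squares[OF G that]) (simp add: d)
  \<comment> \<open>A vector orthogonal to \<open>?W\<close> has sum zero and is annihilated by
    every coordinate functional, so it is a null vector of the form.\<close>
  let ?W = "insert (vec 1) ((\<lambda>i. \<chi> v. f v i) ` {..<m})"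
  have "{x. \<forall>w\<in>?W. w \<bullet> x = 0} \<subseteq> {x \<in> zero_sum. gram_form G (\<alpha>\<^sup>2) (\<beta>\<^sup>2) x = 0}"
    using form by (auto simp: zero_sum_eq)
  then have "dim {x. \<forall>w\<in>?W. w \<bullet> x = 0} \<le> dim {x \<in> zero_sum. gram_form G (\<alpha>\<^sup>2) (\<beta>\<^sup>2) x = 0}"
    by (rule dim_subset)
  moreover have "CARD('v) \<le> dim {x. \<forall>w\<in>?W. w \<bullet> x = 0} + card ?W"
    using dim_orthogonal_to_finite[of ?W] by simp
  moreover have "card ?W \<le> m + 1"
    by (metis Suc_eq_plus1 card_image_le card_insert_le_m1 card_lessThan diff_Suc_1 finite_lessThan
        zero_less_Suc)
  ultimately have "CARD('v) \<le> dim {x \<in> zero_sum. gram_form G (\<alpha>\<^sup>2) (\<beta>\<^sup>2) x = 0} + m + 1" by simp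
  moreover have "\<forall>x\<in>zero_sum. 0 \<le> gram_form G (\<alpha>\<^sup>2) (\<beta>\<^sup>2) x"
    using form by (simp add: sum_nonneg)
  moreover have "\<alpha>\<^sup>2 \<noteq> \<beta>\<^sup>2" using pos by (simp add: power2_eq_iff_nonneg)
  ultimately show "\<exists>a b. 0 < a \<and> 0 < b \<and> a \<noteq> b \<and>
      (\<forall>x\<in>zero_sum. 0 \<le> gram_form G a b x) \<and>
      CARD('v) \<le> dim {x \<in> zero_sum. gram_form G a b x = 0} + m + 1"
    using pos by (intro exI[of _ "\<alpha>\<^sup>2"] exI[of _ "\<beta>\<^sup>2"]) auto
next
  assume "\<exists>a b. 0 < a \<and> 0 < b \<and> a \<noteq> b \<and>
      (\<forall>x\<in>zero_sum. 0 \<le> gram_form G a b x) \<and>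
      CARD('v) \<le> dim {x \<in> zero_sum. gram_form G a b x = 0} + m + 1"
  then obtain a b where ab: "0 < a" "0 < b" "a \<noteq> b"
    and nonneg: "\<And>x. x \<in> zero_sum \<Longrightarrow> 0 \<le> gram_form G a b x"
    and d: "CARD('v) \<le> dim {x \<in> zero_sum. gram_form G a b x = 0} + m + 1" by blast
  interpret A: self_adjoint "(*v) (adjacency_matrix G)"
    by (rule self_adjoint_adjacency_matrix[OF G])
  let ?T = "\<lambda>x. b *\<^sub>R x + (b - a) *\<^sub>R (adjacency_matrix G *v x)"
  have form: "x \<bullet> ?T x = gram_form G a b x" for x
    by (simp add: gram_form_def inner_add_right)
  have "self_adjoint ?T"
  proof (rule self_adjoint.intro)
    show "linear ?T"
      by (intro linear_compose_add linear_compose_scale_right linear_ident A.linear)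
    show "x \<bullet> ?T y = ?T x \<bullet> y" for x y
      using A.sym[of x y] by (simp only: inner_add_right inner_add_left inner_scaleR_left inner_scaleR_right)
  qed
  then obtain g :: "nat \<Rightarrow> real^'v" where g: "\<forall>x\<in>zero_sum. gram_form G a b x = (\<Sum>i<m. (g i \<bullet> x)\<^sup>2)"
    using nonneg_form_sum_of_squares[of ?T zero_sum m] nonneg d dim_zero_sum[where 'n='v]
    unfolding form by (auto simp: subspace_zero_sum)
  \<comment> \<open>The form at a difference of two axis vectors is twice a squared distance, hence
    the scaling.\<close>
  let ?f = "\<lambda>v i. g i $ v / sqrt 2"
  have "euclidean_dist m (?f u) (?f v) = (if G u v then sqrt a else sqrt b)" if "u \<noteq> v" for u v
  proof -
    have "(\<Sum>i<m. (?f u i - ?f v i)\<^sup>2) = (\<Sum>i<m. (g i \<bullet> (axis u 1 - axis v 1))\<^sup>2) / 2"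
      unfolding sum_divide_distrib
      by (intro sum.cong refl) (simp add: inner_diff_right inner_axis power_divide flip: diff_divide_distrib)
    also have "\<dots> = (if G u v then a else b)"
      using g gram_form_axis_diff[OF G that, of a b] zero_sum_axis_diff[of u 1 v] by simp
    finally show ?thesis by (simp add: euclidean_dist_def L2_set_def)
  qed
  then show "representable G m"
    unfolding representable_def using ab
    by (intro exI[of _ ?f] exI[of _ "sqrt a"] exI[of _ "sqrt b"]) simp
qed

section \<open>The representation number as a codimension\<close>

text \<open>This replaces reachability by the absence of an induced path on three vertices. Under
  that condition, induction along a walk shows that its ends are equal or adjacent.\<close>

lemma disjoint_union_of_complete_iff:
  assumes "simple_graph G"
  shows "disjoint_union_of_complete G \<longleftrightarrow> (\<forall>u v w. G u v \<longrightarrow> G v w \<longrightarrow> u \<noteq> w \<longrightarrow> G u w)"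
proof
  assume *: "disjoint_union_of_complete G"
  show "\<forall>u v w. G u v \<longrightarrow> G v w \<longrightarrow> u \<noteq> w \<longrightarrow> G u w"
  proof (intro allI impI)
    fix u v w assume "G u v" "G v w" "u \<noteq> w"
    let ?C = "{x. G\<^sup>*\<^sup>* u x}"
    have "G\<^sup>*\<^sup>* u w"
      using \<open>G u v\<close> r_into_rtranclp[of G v w] \<open>G v w\<close>
      by (simp add: converse_rtranclp_into_rtranclp[of G u v w])
    then have "u \<in> ?C" "w \<in> ?C" by simp_all
    moreover have "?C \<in> connected_components G"
      unfolding connected_components_def by (rule UN_I[of u]) simp_all
    ultimately show "G u w"
      using *[unfolded disjoint_union_of_complete_def, rule_format] \<open>u \<noteq> w\<close> by metis
  qed
next
  assume *: "\<forall>u v w. G u v \<longrightarrow> G v w \<longrightarrow> u \<noteq> w \<longrightarrow> G u w"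
  have path: "u = v \<or> G u v" if "G\<^sup>*\<^sup>* u v" for u v
    using that
  proof (induction rule: rtranclp_induct)
    case (step y z)
    then show ?case using * by metis
  qed simp
  have sym: "G v u" if "G u v" for u v
    using assms that by (simp add: simple_graph_def sympD)
  show "disjoint_union_of_complete G"
    unfolding disjoint_union_of_complete_def connected_components_def
  proof (intro ballI impI)
    fix C u v assume "C \<in> (\<Union>u. {{v. G\<^sup>*\<^sup>* u v}})" "u \<in> C" "v \<in> C" "u \<noteq> v"
    then obtain t where "G\<^sup>*\<^sup>* t u" "G\<^sup>*\<^sup>* t v" by auto
    then show "G u v" using path[of t u] path[of t v] sym * \<open>u \<noteq> v\<close> by metis
  qed
qed

lemma orthogonal_zero_sum_imp_constant:
  assumes "\<And>y. y \<in> zero_sum \<Longrightarrow> y \<bullet> z = 0"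
  shows "\<exists>c. \<forall>v. z $ v = c"
proof -
  \<comment> \<open>\<open>undefined\<close> is just a fixed reference vertex.\<close>
  have "z $ v = z $ undefined" for v
    using assms[OF zero_sum_axis_diff[of v 1 undefined]] by (simp add: inner_diff_left inner_axis')
  then show ?thesis by blast
qed

text \<open>This is the least eigenvalue of the compression of the adjacency matrix to
  \<open>zero_sum\<close>. With at least two vertices, \<open>rayleigh_min_compressed_min\<close>
  shows that the description is met by exactly one value.\<close>

definition compressed_min :: "'v::finite graph \<Rightarrow> real" where
  "compressed_min G = (THE l. rayleigh_min ((*v) (adjacency_matrix G)) zero_sum l)"

abbreviation compressed_space :: "'v::finite graph \<Rightarrow> (real^'v) set" where
  "compressed_space G \<equiv> rayleigh_space ((*v) (adjacency_matrix G)) zero_sum (compressed_min G)"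

lemma rayleigh_min_compressed_min:
  fixes G :: "'v::finite graph"
  assumes "simple_graph G" "2 \<le> CARD('v)"
  shows "rayleigh_min ((*v) (adjacency_matrix G)) zero_sum (compressed_min G)"
proof -
  have "(zero_sum :: (real^'v) set) \<noteq> {0}"
  proof
    assume "(zero_sum :: (real^'v) set) = {0}"
    then have "dim (zero_sum :: (real^'v) set) = 0" by (simp only: dim_eq_0)
    then show False using dim_zero_sum[where 'n='v] assms(2) by linarith
  qed
  then obtain l where l: "rayleigh_min ((*v) (adjacency_matrix G)) zero_sum l"
    by (rule self_adjoint.rayleigh_min_exists[OF self_adjoint_adjacency_matrix[OF assms(1)]
          subspace_zero_sum])
  show ?thesis unfolding compressed_min_def
  proof (rule theI)
    show "rayleigh_min ((*v) (adjacency_matrix G)) zero_sum l" by (rule l)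
    show "k = l" if "rayleigh_min ((*v) (adjacency_matrix G)) zero_sum k" for k
      by (rule rayleigh_min_unique[OF that l])
  qed
qed

lemma compressed_space_nontrivial:
  fixes G :: "'v::finite graph"
  assumes "simple_graph G" "2 \<le> CARD('v)"
  obtains x where "x \<in> compressed_space G" "x \<noteq> 0"
  using rayleigh_min_compressed_min[OF assms] that unfolding rayleigh_min_def rayleigh_space_def by blast

text \<open>The constant \<open>c\<close> is the Lagrange multiplier of the sum-zero constraint: the
  defect of the eigenvector equation is orthogonal to \<open>zero_sum\<close>, so it is a constant
  vector.\<close>

lemma compressed_space_nth:
  fixes G :: "'v::finite graph"
  assumes "simple_graph G" "2 \<le> CARD('v)" "x \<in> compressed_space G"
  shows "\<exists>c. \<forall>v. (adjacency_matrix G *v x) $ v = compressed_min G * x $ v + c"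
proof -
  have "y \<bullet> (adjacency_matrix G *v x - compressed_min G *\<^sub>R x) = 0" if "y \<in> zero_sum" for y
    using that assms(3)
    unfolding self_adjoint.rayleigh_space_iff[OF self_adjoint_adjacency_matrix[OF assms(1)]
        subspace_zero_sum rayleigh_min_compressed_min[OF assms(1,2)]]
    by (simp add: inner_diff_right)
  then obtain c where "\<And>v. (adjacency_matrix G *v x - compressed_min G *\<^sub>R x) $ v = c"
    using orthogonal_zero_sum_imp_constant by blast
  then have "(adjacency_matrix G *v x) $ v = compressed_min G * x $ v + c" for v
    by (simp add: diff_eq_eq)
  then show ?thesis by blast
qed

lemma subspace_compressed_space:
  fixes G :: "'v::finite graph"
  assumes "simple_graph G" "2 \<le> CARD('v)"
  shows "subspace (compressed_space G)"
  using self_adjoint.subspace_rayleigh_space[OF self_adjoint_adjacency_matrix[OF assms(1)]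
      subspace_zero_sum rayleigh_min_compressed_min[OF assms]] .

text \<open>The vector with entries \<open>1, -2, 1\<close> along an induced path has Rayleigh quotient \<open>-4/3\<close>.\<close>

lemma compressed_min_less:
  fixes G :: "'v::finite graph"
  assumes G: "simple_graph G" "2 \<le> CARD('v)" and "\<not> disjoint_union_of_complete G"
  shows "compressed_min G < - 1"
proof -
  obtain u v w where uvw: "G u v" "G v w" "u \<noteq> w" "\<not> G u w"
    using assms by (auto simp: disjoint_union_of_complete_iff)
  have sym: "G s t \<longleftrightarrow> G t s" and irr: "\<not> G s s" for s t
    using G by (auto simp: simple_graph_def irreflp_def dest: sympD)
  have adj: "G v u" "G w v" "\<not> G w u" "u \<noteq> v" "v \<noteq> w" using uvw sym irr by metis+
  define x :: "real^'v" where "x = (axis u 1 - axis v 1) + (axis w 1 - axis v 1)"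
  have x: "x \<in> zero_sum"
    unfolding x_def by (intro subspace_add[OF subspace_zero_sum] zero_sum_axis_diff)
  have nth: "x $ u = 1" "x $ v = -2" "x $ w = 1"
    using uvw adj by (auto simp: x_def axis_def)
  have Ax: "(adjacency_matrix G *v x) $ s = (if G s u then 1 else 0) + (if G s w then 1 else 0)
      - 2 * (if G s v then 1 else 0)" for s
    unfolding x_def matrix_vector_right_distrib matrix_vector_mult_diff_distrib matrix_vector_mult_basis
    by (simp add: column_def adjacency_matrix_def)
  have dot: "x \<bullet> y = y $ u + y $ w - 2 * y $ v" for y
    unfolding x_def inner_add_left inner_diff_left inner_axis' by simp
  have "x \<bullet> (adjacency_matrix G *v x) = - (4/3) * (x \<bullet> x)"
    unfolding dot Ax nth using uvw adj irr by simp
  moreover have "x \<noteq> 0" using nth(1) by auto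
  ultimately have "compressed_min G \<le> - (4/3)"
    by (intro rayleigh_min_mono[OF rayleigh_min_compressed_min[OF G] x]) auto
  then show ?thesis by simp
qed

text \<open>All entries have the sign of \<open>c\<close>, so they can add up to zero only if
  \<open>c\<close> is zero.\<close>

lemma zero_sum_eq_0_of_sgn:
  fixes x :: "real^'n"
  assumes "x \<in> zero_sum" and pos: "\<And>v. 0 < k v" and eq: "\<And>v. k v * x $ v = c"
  shows "x = 0"
proof -
  have x: "x $ v = c / k v" for v using pos[of v] eq[of v] by (simp add: field_simps)
  then have "0 = c * (\<Sum>v\<in>UNIV. 1 / k v)"
    using assms(1) by (simp add: zero_sum_def sum_distrib_left)
  moreover have "0 < (\<Sum>v\<in>UNIV. 1 / k v)" using pos by (intro sum_pos) auto
  ultimately show ?thesis using x by (simp add: vec_eq_iff)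
qed

text \<open>In a disjoint union of complete graphs this is the component of \<open>v\<close>. In any
  simple graph, adding the identity to the adjacency matrix gives the operator that sums over these
  sets.\<close>

definition closed_nbhd :: "'v graph \<Rightarrow> 'v \<Rightarrow> 'v set" where
  "closed_nbhd G v = {w. v = w \<or> G v w}"

lemma sum_closed_nbhd:
  assumes "simple_graph G"
  shows "(\<Sum>w\<in>closed_nbhd G v. x $ w) = (adjacency_matrix G *v x) $ v + x $ v"
proof -
  have "v \<notin> {w. G v w}" "closed_nbhd G v = insert v {w. G v w}"
    using assms by (auto simp: closed_nbhd_def simple_graph_def irreflp_def)
  then show ?thesis by (simp add: adjacency_matrix_mult_nth sum.If_cases)
qed

lemma closed_nbhd_eq:
  assumes "simple_graph G" "disjoint_union_of_complete G" "w \<in> closed_nbhd G v"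
  shows "closed_nbhd G w = closed_nbhd G v"
proof -
  have "symp G" using assms(1) by (simp add: simple_graph_def)
  then show ?thesis
    using assms(3) assms(2)[unfolded disjoint_union_of_complete_iff[OF assms(1)]]
    unfolding closed_nbhd_def by (auto dest: sympD)
qed

text \<open>The left side of \<open>eq\<close> is the sum of \<open>x\<close> over the component of
  \<open>v\<close>, hence the same for all its vertices. As \<open>z\<close> is nonzero,
  \<open>x\<close> is constant there, and the sum is the component size times that constant.\<close>

lemma component_sums_eq_imp:
  assumes "simple_graph G" "disjoint_union_of_complete G" "z \<noteq> 0"
    and eq: "\<And>v. (adjacency_matrix G *v x) $ v + x $ v = z * x $ v + c"
  shows "w \<in> closed_nbhd G v \<Longrightarrow> x $ w = x $ v"
    and "(real (card (closed_nbhd G v)) - z) * x $ v = c"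
proof -
  have const: "x $ w = x $ v" if "w \<in> closed_nbhd G v" for v w
    using eq[of v] eq[of w] assms(3) closed_nbhd_eq[OF assms(1,2) that]
    unfolding sum_closed_nbhd[OF assms(1), symmetric] by simp
  show "w \<in> closed_nbhd G v \<Longrightarrow> x $ w = x $ v" by (rule const)
  have "(\<Sum>w\<in>closed_nbhd G v. x $ w) = card (closed_nbhd G v) * x $ v"
    using const by simp
  then show "(real (card (closed_nbhd G v)) - z) * x $ v = c"
    using eq[of v] unfolding sum_closed_nbhd[OF assms(1)] by (simp add: algebra_simps)
qed

text \<open>For a value below -1, every factor
  \<open>card (closed_nbhd G v) - (compressed_min G + 1)\<close> is positive, and a minimizer would
  have entries of one sign with sum zero.\<close>

lemma compressed_min_ge:
  fixes G :: "'v::finite graph"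
  assumes G: "simple_graph G" "2 \<le> CARD('v)" and duc: "disjoint_union_of_complete G"
  shows "- 1 \<le> compressed_min G"
proof (rule ccontr)
  assume "\<not> ?thesis"
  then have neg: "compressed_min G + 1 < 0" by simp
  obtain x where x: "x \<in> compressed_space G" "x \<noteq> 0" by (rule compressed_space_nontrivial[OF G])
  obtain c where "\<And>v. (adjacency_matrix G *v x) $ v = compressed_min G * x $ v + c"
    using compressed_space_nth[OF G x(1)] by blast
  then have "(real (card (closed_nbhd G v)) - (compressed_min G + 1)) * x $ v = c" for v
    using neg by (intro component_sums_eq_imp(2)[OF G(1) duc]) (auto simp: algebra_simps)
  then have "x = 0"
    using x(1) neg
    by (intro zero_sum_eq_0_of_sgn[of x
          "\<lambda>v. real (card (closed_nbhd G v)) - (compressed_min G + 1)" c])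
      (auto simp: rayleigh_space_def)
  then show False using x(2) by simp
qed

text \<open>
  How far below \<open>CARD('v) - 1\<close> representations in which edges are shorter than non-edges can
  push the dimension.
\<close>

definition excess :: "'v::finite graph \<Rightarrow> nat" where
  "excess G = (if disjoint_union_of_complete G then 0 else dim (compressed_space G))"

lemma excess_less: "excess (G :: 'v::finite graph) < CARD('v)"
proof -
  have "dim (compressed_space G) \<le> dim (zero_sum :: (real^'v) set)"
    by (intro dim_subset) (auto simp: rayleigh_space_def)
  then show ?thesis using dim_zero_sum[where 'n='v] unfolding excess_def by auto
qed

text \<open>Here \<open>t\<close> stands for \<open>b / (b - a)\<close>, so \<open>t > 1\<close>
  expresses \<open>a > 0\<close>. Below \<open>- compressed_min G\<close> the form takes negative
  values, and above it the form is positive definite on \<open>zero_sum\<close>. Only equality gives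
  a nontrivial null space.\<close>

lemma excess_iff:
  fixes G :: "'v::finite graph"
  assumes G: "simple_graph G" "2 \<le> CARD('v)"
  shows "(\<exists>t>1. (\<forall>x\<in>zero_sum. 0 \<le> x \<bullet> (adjacency_matrix G *v x) + t * (x \<bullet> x)) \<and>
      CARD('v) \<le> dim {x \<in> zero_sum. x \<bullet> (adjacency_matrix G *v x) + t * (x \<bullet> x) = 0} + m + 1)
    \<longleftrightarrow> CARD('v) \<le> excess G + m + 1" (is "(\<exists>t>1. ?P t) \<longleftrightarrow> _")
proof
  let ?q = "\<lambda>x. x \<bullet> (adjacency_matrix G *v x)" and ?l = "compressed_min G"
  note min = rayleigh_min_compressed_min[OF G]
  assume "\<exists>t>1. ?P t"
  then obtain t where t: "t > 1" "\<forall>x\<in>zero_sum. 0 \<le> ?q x + t * (x \<bullet> x)"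
    "CARD('v) \<le> dim {x \<in> zero_sum. ?q x + t * (x \<bullet> x) = 0} + m + 1" by blast
  obtain x where x: "x \<in> compressed_space G" "x \<noteq> 0" by (rule compressed_space_nontrivial[OF G])
  then have "0 \<le> (?l + t) * (x \<bullet> x)"
    using t(2) by (auto simp: rayleigh_space_def algebra_simps)
  moreover have "0 < x \<bullet> x" using x(2) by simp
  ultimately have "0 \<le> ?l + t" by (simp add: zero_le_mult_iff)
  then consider "t = - ?l" | "0 < ?l + t" by linarith
  then show "CARD('v) \<le> excess G + m + 1"
  proof cases
    case 1
    then have "\<not> disjoint_union_of_complete G" using t(1) compressed_min_ge[OF G] by auto
    moreover have "{x \<in> zero_sum. ?q x + t * (x \<bullet> x) = 0} = compressed_space G"
      using 1 by (auto simp: rayleigh_space_def)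
    ultimately show ?thesis using t(3) by (simp add: excess_def)
  next
    case 2
    have "x = 0" if "x \<in> zero_sum" "?q x + t * (x \<bullet> x) = 0" for x
    proof (rule ccontr)
      assume "x \<noteq> 0"
      then have "0 < (?l + t) * (x \<bullet> x)" using 2 by simp
      then show False using rayleigh_min_le[OF min that(1)] that(2) by (simp add: algebra_simps)
    qed
    then have "{x \<in> zero_sum. ?q x + t * (x \<bullet> x) = 0} \<subseteq> {0}" by blast
    then have "dim {x \<in> zero_sum. ?q x + t * (x \<bullet> x) = 0} = 0" by (simp only: dim_eq_0)
    then show ?thesis using t(3) by linarith
  qed
next
  let ?l = "compressed_min G"
  note min = rayleigh_min_compressed_min[OF G]
  assume le: "CARD('v) \<le> excess G + m + 1"
  show "\<exists>t>1. ?P t"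
  proof (cases "disjoint_union_of_complete G")
    case True
    have "0 \<le> x \<bullet> (adjacency_matrix G *v x) + 2 * (x \<bullet> x)" if "x \<in> zero_sum" for x
    proof -
      have "- 1 * (x \<bullet> x) \<le> ?l * (x \<bullet> x)"
        using compressed_min_ge[OF G True] by (intro mult_right_mono) auto
      then show ?thesis using rayleigh_min_le[OF min that] inner_ge_zero[of x] by linarith
    qed
    \<comment> \<open>Since \<open>compressed_min G\<close> is at least -1, the form is nonnegative
      for \<open>t = 2\<close>, and excess 0 asks nothing of the null space.\<close>
    then show ?thesis using le True by (intro exI[of _ 2]) (simp add: excess_def)
  next
    case False
    then have "{x \<in> zero_sum. x \<bullet> (adjacency_matrix G *v x) + - ?l * (x \<bullet> x) = 0} = compressed_space G"
      by (auto simp: rayleigh_space_def)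
    then show ?thesis
      using le False compressed_min_less[OF G False] rayleigh_min_le[OF min]
      by (intro exI[of _ "- ?l"]) (simp add: excess_def)
  qed
qed

lemma gram_form_complement:
  assumes "simple_graph G" "x \<in> zero_sum"
  shows "gram_form (complement_graph G) b a x = gram_form G a b x"
  by (simp add: gram_form_def adjacency_complement_graph[OF assms] inner_diff_right algebra_simps)

lemma gram_form_scale:
  assumes "a < b"
  shows "gram_form G a b x
    = (b - a) * (x \<bullet> (adjacency_matrix G *v x) + (b / (b - a)) * (x \<bullet> x))"
  using assms by (simp add: gram_form_def distrib_left)

text \<open>Squared distances \<open>a < b\<close> are treated by \<open>excess_iff\<close> for
  \<open>G\<close>. For \<open>b < a\<close> the complement has the same form with the two distances
  exchanged.\<close>

lemma representable_iff_excess: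
  fixes G :: "'v::finite graph"
  assumes G: "simple_graph G" "2 \<le> CARD('v)"
  shows "representable G m \<longleftrightarrow> CARD('v) \<le> max (excess G) (excess (complement_graph G)) + m + 1"
proof -
  define R where "R H a b \<longleftrightarrow> (\<forall>x\<in>zero_sum. 0 \<le> gram_form H a b x) \<and>
      CARD('v) \<le> dim {x \<in> zero_sum. gram_form H a b x = 0} + m + 1" for H :: "'v graph" and a b
  define Q where "Q H t \<longleftrightarrow> (\<forall>x\<in>zero_sum. 0 \<le> x \<bullet> (adjacency_matrix H *v x) + t * (x \<bullet> x)) \<and>
      CARD('v) \<le> dim {x \<in> zero_sum. x \<bullet> (adjacency_matrix H *v x) + t * (x \<bullet> x) = 0} + m + 1"
    for H :: "'v graph" and t
  have RQ: "R H a b \<longleftrightarrow> Q H (b / (b - a))" if "a < b" for H a b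
    using that unfolding R_def Q_def gram_form_scale[OF that] by (simp add: zero_le_mult_iff)
  have "(\<exists>a b. 0 < a \<and> a < b \<and> R H a b) \<longleftrightarrow> (\<exists>t>1. Q H t)" for H
  proof
    assume "\<exists>a b. 0 < a \<and> a < b \<and> R H a b"
    then obtain a b where ab: "0 < a" "a < b" "R H a b" by blast
    then have "1 < b / (b - a)" by (simp add: field_simps)
    then show "\<exists>t>1. Q H t" using ab RQ by blast
  next
    assume "\<exists>t>1. Q H t"
    then obtain t where "t > 1" "Q H t" by blast
    \<comment> \<open>Only the ratio matters, so the difference of the squared distances may be
      taken as 1.\<close>
    then show "\<exists>a b. 0 < a \<and> a < b \<and> R H a b"
      using RQ[of "t - 1" t H] by (intro exI[of _ "t - 1"] exI[of _ t]) simp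
  qed
  note lt = this
  have swap: "R (complement_graph G) b a = R G a b" for a b
  proof -
    have "{x \<in> zero_sum. gram_form (complement_graph G) b a x = 0}
        = {x \<in> zero_sum. gram_form G a b x = 0}"
      using gram_form_complement[OF G(1)] by auto
    then show ?thesis unfolding R_def using gram_form_complement[OF G(1)] by simp
  qed
  have "(\<exists>a b. 0 < a \<and> 0 < b \<and> a \<noteq> b \<and> R G a b) \<longleftrightarrow>
      (\<exists>a b. 0 < a \<and> a < b \<and> R G a b) \<or> (\<exists>b a. 0 < b \<and> b < a \<and> R G a b)"
    by (auto simp: neq_iff) (use order_less_trans in blast)+
  then have "(\<exists>a b. 0 < a \<and> 0 < b \<and> a \<noteq> b \<and> R G a b) \<longleftrightarrow>
      (\<exists>t>1. Q G t) \<or> (\<exists>t>1. Q (complement_graph G) t)"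
    using lt[of G] lt[of "complement_graph G"] unfolding swap by simp
  moreover have "(\<exists>t>1. Q G t) \<longleftrightarrow> CARD('v) \<le> excess G + m + 1"
    unfolding Q_def by (rule excess_iff[OF G])
  moreover have "(\<exists>t>1. Q (complement_graph G) t) \<longleftrightarrow> CARD('v) \<le> excess (complement_graph G) + m + 1"
    unfolding Q_def by (rule excess_iff[OF simple_complement_graph[OF G(1)] G(2)])
  ultimately show ?thesis
    unfolding representable_iff_gram_form[OF G(1)] R_def[symmetric] by (simp add: max_def) linarith
qed

theorem Rep_eq_excess:
  fixes G :: "'v::finite graph"
  assumes G: "simple_graph G" "2 \<le> CARD('v)"
  shows "int (Rep G) = int CARD('v) - 1 - int (max (excess G) (excess (complement_graph G)))"
proof -
  let ?e = "max (excess G) (excess (complement_graph G))"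
  \<comment> \<open>This bound keeps the truncated subtraction on natural numbers exact.\<close>
  have "?e < CARD('v)" using excess_less[of G] excess_less[of "complement_graph G"] by simp
  moreover from this have "Rep G = CARD('v) - 1 - ?e"
    unfolding Rep_def representable_iff_excess[OF G] by (intro Least_equality) linarith+
  ultimately show ?thesis by linarith
qed

section \<open>Comparison with the spectrum\<close>

text \<open>Choosing one eigenvector per eigenvalue gives an orthogonal, hence independent, family.
  Finiteness gives \<open>Min\<close> in the definitions of the two smallest eigenvalues its
  meaning.\<close>

lemma finite_eigenvalues:
  assumes "self_adjoint ((*v) A)"
  shows "finite (eigenvalues A)"
proof -
  have "\<forall>l\<in>eigenvalues A. \<exists>x. x \<noteq> 0 \<and> A *v x = l *\<^sub>R x"
    by (simp add: eigenvalues_def)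
  then obtain f where f: "\<And>l. l \<in> eigenvalues A \<Longrightarrow> f l \<noteq> 0 \<and> A *v f l = l *\<^sub>R f l"
    by metis
  have orth: "f l \<bullet> f k = 0" if "l \<in> eigenvalues A" "k \<in> eigenvalues A" "l \<noteq> k" for l k
    using f that by (intro self_adjoint.eigenvectors_orthogonal[OF assms, of _ l _ k]) auto
  have "independent (f ` eigenvalues A)"
  proof (rule pairwise_orthogonal_independent)
    show "pairwise orthogonal (f ` eigenvalues A)"
      unfolding pairwise_def orthogonal_def using orth by blast
    show "0 \<notin> f ` eigenvalues A" using f by force
  qed
  then have "finite (f ` eigenvalues A)" using independent_bound by blast
  moreover have "inj_on f (eigenvalues A)"
    using f orth by (metis inj_onI inner_eq_zero_iff)
  ultimately show ?thesis by (rule finite_imageD)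
qed

text \<open>The whole space is invariant, so a minimizer is an eigenvector; every eigenvalue is
  itself a Rayleigh quotient, so none is smaller.\<close>

lemma rayleigh_min_smallest_eigenvalue:
  assumes "self_adjoint ((*v) A)"
  shows "rayleigh_min ((*v) A) UNIV (smallest_eigenvalue A)"
proof -
  interpret T: self_adjoint "(*v) A" by fact
  have "(axis undefined 1 :: real^'a) \<noteq> 0" by (simp add: axis_eq_0_iff)
  then have "(UNIV :: (real^'a) set) \<noteq> {0}" by blast
  then obtain l where l: "rayleigh_min ((*v) A) UNIV l"
    by (rule T.rayleigh_min_exists[OF subspace_UNIV])
  then obtain x where x: "x \<noteq> 0" "x \<bullet> (A *v x) = l * (x \<bullet> x)"
    by (auto simp: rayleigh_min_def)
  then have "x \<in> rayleigh_space ((*v) A) UNIV l" by (simp add: rayleigh_space_def)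
  then have "A *v x = l *\<^sub>R x"
    using T.rayleigh_space_invariant[OF subspace_UNIV l] by blast
  then have "l \<in> eigenvalues A" using x(1) by (auto simp: eigenvalues_def)
  moreover have "l \<le> k" if k: "k \<in> eigenvalues A" for k
  proof -
    obtain y where "y \<noteq> 0" "A *v y = k *\<^sub>R y" using k by (auto simp: eigenvalues_def)
    then show ?thesis by (intro rayleigh_min_mono[OF l, of y]) auto
  qed
  ultimately have "smallest_eigenvalue A = l"
    unfolding smallest_eigenvalue_def by (intro Min_eqI finite_eigenvalues[OF assms])
  then show ?thesis using l by simp
qed

lemma eigenspace_smallest_eigenvalue:
  assumes "self_adjoint ((*v) A)"
  shows "rayleigh_space ((*v) A) UNIV (smallest_eigenvalue A)
    = {x. A *v x = smallest_eigenvalue A *\<^sub>R x}"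
  using self_adjoint.rayleigh_space_invariant[OF assms subspace_UNIV
      rayleigh_min_smallest_eigenvalue[OF assms]] by simp

lemma subspace_eigenspace:
  fixes A :: "real^'n^'n"
  shows "subspace {x. A *v x = l *\<^sub>R x}"
  by (intro subspaceI)
    (simp_all add: matrix_vector_right_distrib matrix_vector_mult_scaleR scaleR_right_distrib)

text \<open>\<open>U\<close> is the orthogonal complement of the smallest eigenspace. It is
  invariant by symmetry and contains the eigenvectors of all other eigenvalues, so the minimum over
  it is the next eigenvalue.\<close>

lemma second_smallest_eigenvalue_rayleigh:
  fixes A :: "real^'n^'n"
  assumes "self_adjoint ((*v) A)"
  defines "U \<equiv> {x. \<forall>y. A *v y = smallest_eigenvalue A *\<^sub>R y \<longrightarrow> y \<bullet> x = 0}"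
  assumes "U \<noteq> {0}"
  shows "rayleigh_min ((*v) A) U (second_smallest_eigenvalue A)"
    and "rayleigh_space ((*v) A) U (second_smallest_eigenvalue A)
      = {x \<in> U. A *v x = second_smallest_eigenvalue A *\<^sub>R x}"
proof -
  interpret T: self_adjoint "(*v) A" by fact
  have sub: "subspace U" unfolding U_def by (intro subspaceI) (auto simp: inner_add_right)
  have "A *v x \<in> U" if x: "x \<in> U" for x
  proof -
    have "y \<bullet> (A *v x) = 0" if y: "A *v y = smallest_eigenvalue A *\<^sub>R y" for y
    proof -
      have "y \<bullet> x = 0" using x y unfolding U_def by blast
      then show ?thesis unfolding T.sym[of y x] y by simp
    qed
    then show ?thesis unfolding U_def by blast
  qed
  then have inv: "(*v) A ` U \<subseteq> U" by blast
  obtain l where l: "rayleigh_min ((*v) A) U l"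
    by (rule T.rayleigh_min_exists[OF sub \<open>U \<noteq> {0}\<close>])
  note space = T.rayleigh_space_invariant[OF sub l inv]
  obtain x where x: "x \<in> U" "x \<noteq> 0" "x \<bullet> (A *v x) = l * (x \<bullet> x)"
    using l unfolding rayleigh_min_def by blast
  then have "x \<in> rayleigh_space ((*v) A) U l" by (simp add: rayleigh_space_def)
  then have Ax: "A *v x = l *\<^sub>R x" using space by blast
  then have "l \<in> eigenvalues A" using x(2) by (auto simp: eigenvalues_def)
  moreover have "l \<noteq> smallest_eigenvalue A"
  proof
    assume "l = smallest_eigenvalue A"
    then have "x \<bullet> x = 0" using Ax x(1) unfolding U_def by blast
    then show False using x(2) by simp
  qed
  moreover have "l \<le> k" if k: "k \<in> eigenvalues A - {smallest_eigenvalue A}" for k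
  proof -
    obtain y where y: "y \<noteq> 0" "A *v y = k *\<^sub>R y" using k by (auto simp: eigenvalues_def)
    have "z \<bullet> y = 0" if "A *v z = smallest_eigenvalue A *\<^sub>R z" for z
      using T.eigenvectors_orthogonal[OF that y(2)] k by simp
    then have "y \<in> U" unfolding U_def by blast
    then show ?thesis using y by (intro rayleigh_min_mono[OF l, of y]) auto
  qed
  ultimately have eq: "second_smallest_eigenvalue A = l"
    unfolding second_smallest_eigenvalue_def
    by (intro Min_eqI finite_Diff finite_eigenvalues[OF assms(1)]) auto
  show "rayleigh_min ((*v) A) U (second_smallest_eigenvalue A)" using l eq by simp
  show "rayleigh_space ((*v) A) U (second_smallest_eigenvalue A)
      = {x \<in> U. A *v x = second_smallest_eigenvalue A *\<^sub>R x}" using space eq by simp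
qed

section \<open>Interlacing between the whole space and \<open>zero_sum\<close>\<close>

context
  fixes G :: "'v::finite graph" and A :: "real^'v^'v" and e :: real
  assumes G: "simple_graph G" "2 \<le> CARD('v)"
  defines "A \<equiv> adjacency_matrix G" and "e \<equiv> smallest_eigenvalue (adjacency_matrix G)"
begin

interpretation T: self_adjoint "(*v) A"
  unfolding A_def by (rule self_adjoint_adjacency_matrix[OF G(1)])

lemma rayleigh_min_adjacency_matrix: "rayleigh_min ((*v) A) UNIV e"
  unfolding A_def e_def
  by (rule rayleigh_min_smallest_eigenvalue[OF self_adjoint_adjacency_matrix[OF G(1)]])

lemma rayleigh_min_zero_sum: "rayleigh_min ((*v) A) zero_sum (compressed_min G)"
  unfolding A_def by (rule rayleigh_min_compressed_min[OF G])

lemma smallest_eigenvalue_le_compressed_min: "e \<le> compressed_min G"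
  by (rule rayleigh_min_antimono[OF rayleigh_min_adjacency_matrix rayleigh_min_zero_sum]) simp

lemma smallest_eigenspace_iff: "A *v x = e *\<^sub>R x \<longleftrightarrow> x \<bullet> (A *v x) = e * (x \<bullet> x)"
  using eigenspace_smallest_eigenvalue[OF T.self_adjoint_axioms]
  unfolding rayleigh_space_def A_def e_def by blast

lemma compressed_min_eq_smallest_eigenvalue:
  assumes "x \<in> zero_sum" "x \<noteq> 0" "A *v x = e *\<^sub>R x"
  shows "compressed_min G = e"
proof (rule antisym[OF _ smallest_eigenvalue_le_compressed_min])
  show "compressed_min G \<le> e"
    using assms by (intro rayleigh_min_mono[OF rayleigh_min_zero_sum, of x]) auto
qed

lemma compressed_space_eq:
  assumes "compressed_min G = e"
  shows "compressed_space G = {x \<in> {x. A *v x = e *\<^sub>R x}. vec 1 \<bullet> x = 0}"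
  using assms smallest_eigenspace_iff unfolding rayleigh_space_def zero_sum_eq A_def by auto

text \<open>The sum-zero part of the smallest eigenspace loses at most one dimension. If it is
  nontrivial, then the two minima agree and it is exactly \<open>compressed_space G\<close>.\<close>

lemma dim_compressed_space_ge:
  "eigenvalue_multiplicity A e \<le> dim (compressed_space G) + 1"
proof -
  let ?E = "{x. A *v x = e *\<^sub>R x}"
  have le: "dim ?E \<le> dim {x \<in> ?E. vec 1 \<bullet> x = 0} + 1"
    by (rule dim_Int_hyperplane[OF subspace_eigenspace])
  show ?thesis
  proof (cases "{x \<in> ?E. vec 1 \<bullet> x = 0} \<subseteq> {0}")
    case True
    then have "dim {x \<in> ?E. vec 1 \<bullet> x = 0} = 0" by (simp only: dim_eq_0)
    then show ?thesis using le unfolding eigenvalue_multiplicity_def by linarith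
  next
    case False
    then have eq: "compressed_min G = e" using compressed_min_eq_smallest_eigenvalue unfolding zero_sum_eq by blast
    show ?thesis unfolding eigenvalue_multiplicity_def compressed_space_eq[OF eq] by (rule le)
  qed
qed

lemma dim_compressed_space_pos: "1 \<le> dim (compressed_space G)"
proof -
  obtain x where "x \<in> compressed_space G" "x \<noteq> 0" by (rule compressed_space_nontrivial[OF G])
  then have "dim (compressed_space G) \<noteq> 0" unfolding dim_eq_0 by blast
  then show ?thesis by linarith
qed

text \<open>If the two minima differ, no nonzero eigenvector for \<open>e\<close> has sum zero, so
  that eigenspace is a line spanned by some \<open>p\<close>. Orthogonality to \<open>p\<close>
  costs at most one dimension of \<open>compressed_space G\<close>, and what remains consists of
  eigenvectors for the second smallest eigenvalue.\<close>

lemma dim_compressed_space_le: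
  "dim (compressed_space G)
    \<le> max (eigenvalue_multiplicity A e) (eigenvalue_multiplicity A (second_smallest_eigenvalue A) + 1)"
proof (cases "compressed_min G = e")
  case True
  have "dim (compressed_space G) \<le> eigenvalue_multiplicity A e"
    unfolding compressed_space_eq[OF True] eigenvalue_multiplicity_def by (rule dim_subset) auto
  then show ?thesis by simp
next
  case False
  let ?E = "{x. A *v x = e *\<^sub>R x}" and ?h = "compressed_min G"
    and ?s = "second_smallest_eigenvalue A"
  define U where "U = {x. \<forall>y. A *v y = smallest_eigenvalue A *\<^sub>R y \<longrightarrow> y \<bullet> x = 0}"
  have e: "e = smallest_eigenvalue A" by (simp add: A_def e_def)
  obtain p where p: "p \<noteq> 0" "A *v p = e *\<^sub>R p"
    using rayleigh_min_adjacency_matrix smallest_eigenspace_iff unfolding rayleigh_min_def by auto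
  then have vp: "vec 1 \<bullet> p \<noteq> 0" using compressed_min_eq_smallest_eigenvalue False unfolding zero_sum_eq by blast
  have proj: "y - ((vec 1 \<bullet> y) / (vec 1 \<bullet> p)) *\<^sub>R p \<in> zero_sum" for y
    using vp by (simp add: zero_sum_eq inner_diff_right)
  \<comment> \<open>Subtracting a multiple of \<open>p\<close> makes the sum zero within the
    eigenspace, which leaves only the zero vector.\<close>
  have E: "\<exists>c. y = c *\<^sub>R p" if "A *v y = e *\<^sub>R y" for y
  proof -
    let ?z = "y - ((vec 1 \<bullet> y) / (vec 1 \<bullet> p)) *\<^sub>R p"
    have "A *v ?z = e *\<^sub>R ?z"
      using that p by (simp add: matrix_vector_mult_diff_distrib matrix_vector_mult_scaleR algebra_simps)
    then have "?z = 0" using compressed_min_eq_smallest_eigenvalue[OF proj] False by blast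
    then show ?thesis by (intro exI[of _ "(vec 1 \<bullet> y) / (vec 1 \<bullet> p)"]) simp
  qed
  have U: "x \<in> U \<longleftrightarrow> p \<bullet> x = 0" for x
  proof
    assume "x \<in> U"
    then show "p \<bullet> x = 0" using p(2) unfolding U_def e by blast
  next
    assume "p \<bullet> x = 0"
    then have "y \<bullet> x = 0" if "A *v y = e *\<^sub>R y" for y using E[OF that] by auto
    then show "x \<in> U" unfolding U_def e by blast
  qed
  let ?W = "{x \<in> compressed_space G. p \<bullet> x = 0}"
  have le: "dim (compressed_space G) \<le> dim ?W + 1"
    by (rule dim_Int_hyperplane[OF subspace_compressed_space[OF G]])
  have "dim ?W \<le> eigenvalue_multiplicity A ?s"
  proof (cases "?W \<subseteq> {0}")
    case True
    then have "dim ?W = 0" by (simp only: dim_eq_0)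
    then show ?thesis by linarith
  next
    case False
    then obtain w where w: "w \<in> ?W" "w \<noteq> 0" by blast
    then have "w \<in> U" using U by blast
    then have "U \<noteq> {0}" using w(2) by blast
    note second = second_smallest_eigenvalue_rayleigh[OF T.self_adjoint_axioms this[unfolded U_def],
        folded U_def]
    obtain y where y: "y \<in> U" "y \<noteq> 0" "y \<bullet> (A *v y) = ?s * (y \<bullet> y)"
      using second(1) unfolding rayleigh_min_def by blast
    then have "y \<in> rayleigh_space ((*v) A) U ?s" by (simp add: rayleigh_space_def)
    then have Ay: "A *v y = ?s *\<^sub>R y" using second(2) by blast
    have es: "e \<le> ?s" by (rule rayleigh_min_antimono[OF rayleigh_min_adjacency_matrix second(1)]) simp
    \<comment> \<open>A second eigenvector \<open>y\<close> is moved into \<open>zero_sum\<close>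
      along \<open>p\<close>. As \<open>p\<close> belongs to the smaller eigenvalue
      \<open>e\<close>, the Rayleigh quotient stays at most \<open>?s\<close>.\<close>
    have hs: "?h \<le> ?s"
    proof -
      define c where "c = (vec 1 \<bullet> y) / (vec 1 \<bullet> p)"
      let ?z = "y - c *\<^sub>R p"
      have yp: "p \<bullet> y = 0" "y \<bullet> p = 0" using U y(1) by (auto simp: inner_commute)
      have zz: "?z \<bullet> ?z = y \<bullet> y + c\<^sup>2 * (p \<bullet> p)"
        using yp by (simp add: inner_diff_left inner_diff_right power2_eq_square)
      have "0 < y \<bullet> y" using y(2) by simp
      moreover have "0 \<le> c\<^sup>2 * (p \<bullet> p)" by simp
      ultimately have "0 < ?z \<bullet> ?z" unfolding zz by linarith
      then have "?z \<noteq> 0" by auto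
      have "A *v ?z = ?s *\<^sub>R y - (c * e) *\<^sub>R p"
        by (simp add: matrix_vector_mult_diff_distrib matrix_vector_mult_scaleR Ay p(2))
      then have "?z \<bullet> (A *v ?z) = ?s * (y \<bullet> y) + e * (c\<^sup>2 * (p \<bullet> p))"
        using yp by (simp add: inner_diff_left inner_diff_right power2_eq_square)
      also have "\<dots> \<le> ?s * (?z \<bullet> ?z)"
        unfolding zz distrib_left using es by (intro add_left_mono mult_right_mono) simp_all
      finally show ?thesis
        using rayleigh_min_mono[OF rayleigh_min_zero_sum proj[of y, folded c_def] \<open>?z \<noteq> 0\<close>] by blast
    qed
    have sh: "?s \<le> ?h"
    proof (rule rayleigh_min_mono[OF second(1) \<open>w \<in> U\<close> w(2)])
      show "w \<bullet> (A *v w) \<le> ?h * (w \<bullet> w)" using w(1) by (simp add: rayleigh_space_def A_def)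
    qed
    have "?W \<subseteq> {x. A *v x = ?s *\<^sub>R x}"
    proof
      fix x assume x: "x \<in> ?W"
      then have "x \<bullet> (A *v x) = ?s * (x \<bullet> x)"
        using hs sh by (simp add: rayleigh_space_def A_def)
      then have "x \<in> rayleigh_space ((*v) A) U ?s" using x U by (simp add: rayleigh_space_def)
      then show "x \<in> {x. A *v x = ?s *\<^sub>R x}" using second(2) by blast
    qed
    then show ?thesis unfolding eigenvalue_multiplicity_def by (rule dim_subset)
  qed
  then show ?thesis using le by simp
qed

text \<open>The all-ones vector is an eigenvector for the degree, which is nonnegative, while
  \<open>e\<close> is below -1. So the smallest eigenspace is orthogonal to it and lies in
  \<open>zero_sum\<close>.\<close>

lemma dim_compressed_space_regular:
  assumes "regular G" "\<not> disjoint_union_of_complete G"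
  shows "dim (compressed_space G) = eigenvalue_multiplicity A e"
proof -
  define k where "k = real (vertex_degree G undefined)"
  have "(A *v vec 1) $ v = k" for v
  proof -
    have "vertex_degree G v = vertex_degree G undefined" using assms(1) unfolding regular_def by blast
    then show ?thesis
      by (simp add: A_def adjacency_matrix_mult_nth sum.If_cases k_def vertex_degree_def)
  qed
  then have A1: "A *v vec 1 = k *\<^sub>R vec 1" by (simp add: vec_eq_iff)
  have "e < - 1" using smallest_eigenvalue_le_compressed_min compressed_min_less[OF G assms(2)] by linarith
  then have "k \<noteq> e" unfolding k_def by linarith
  then have orth: "vec 1 \<bullet> x = 0" if "A *v x = e *\<^sub>R x" for x
    by (rule T.eigenvectors_orthogonal[OF A1 that])
  obtain p where p: "p \<noteq> 0" "A *v p = e *\<^sub>R p"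
    using rayleigh_min_adjacency_matrix smallest_eigenspace_iff unfolding rayleigh_min_def by auto
  then have "compressed_min G = e"
    using compressed_min_eq_smallest_eigenvalue orth unfolding zero_sum_eq by blast
  then have "compressed_space G = {x. A *v x = e *\<^sub>R x}"
    using orth unfolding compressed_space_eq[OF \<open>compressed_min G = e\<close>] by blast
  then show ?thesis by (simp add: eigenvalue_multiplicity_def)
qed

end

section \<open>Disjoint unions of complete graphs\<close>

definition set_vec :: "'n set \<Rightarrow> real^'n" where
  "set_vec S = (\<chi> v. if v \<in> S then 1 else 0)"

lemma set_vec_inner: "set_vec S \<bullet> x = (\<Sum>v\<in>S. x $ v)" for x :: "real^'n"
proof -
  have "set_vec S \<bullet> x = (\<Sum>v\<in>UNIV. if v \<in> S then x $ v else 0)"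
    unfolding inner_vec_def set_vec_def by (intro sum.cong) auto
  then show ?thesis by (simp add: sum.If_cases)
qed

lemma set_vec_inner_set_vec: "set_vec S \<bullet> set_vec T = real (card (S \<inter> T))"
  unfolding set_vec_inner by (simp add: set_vec_def sum.If_cases)

lemma set_vec_nth: "set_vec S $ v = (if v \<in> S then 1 else 0)"
  by (simp add: set_vec_def)

context
  fixes G :: "'v::finite graph"
  assumes G: "simple_graph G" and duc: "disjoint_union_of_complete G"
begin

lemma mem_closed_nbhd: "v \<in> closed_nbhd G v"
  by (simp add: closed_nbhd_def)

lemma closed_nbhd_disjoint:
  assumes "closed_nbhd G u \<noteq> closed_nbhd G w"
  shows "closed_nbhd G u \<inter> closed_nbhd G w = {}"
  using closed_nbhd_eq[OF G duc] assms by blast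

lemma mem_closed_nbhd_iff: "v \<in> closed_nbhd G u \<longleftrightarrow> closed_nbhd G v = closed_nbhd G u"
  using closed_nbhd_eq[OF G duc] mem_closed_nbhd by blast

lemma card_closed_nbhd_pos: "0 < card (closed_nbhd G v)"
  using mem_closed_nbhd[of v] by (auto simp: card_gt_0_iff)

lemma connected_components_eq: "connected_components G = range (closed_nbhd G)"
proof -
  have trans: "\<forall>u v w. G u v \<longrightarrow> G v w \<longrightarrow> u \<noteq> w \<longrightarrow> G u w"
    using duc disjoint_union_of_complete_iff[OF G] by blast
  have "{v. G\<^sup>*\<^sup>* u v} = closed_nbhd G u" for u
  proof (intro set_eqI iffI)
    fix v assume "v \<in> {v. G\<^sup>*\<^sup>* u v}"
    then have "G\<^sup>*\<^sup>* u v" by simp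
    then have "u = v \<or> G u v"
    proof (induction rule: rtranclp_induct)
      case (step y z)
      then show ?case using trans by metis
    qed simp
    then show "v \<in> closed_nbhd G u" by (simp add: closed_nbhd_def)
  next
    fix v assume "v \<in> closed_nbhd G u"
    then show "v \<in> {v. G\<^sup>*\<^sup>* u v}"
      using r_into_rtranclp[of G u v] by (auto simp: closed_nbhd_def)
  qed
  then show ?thesis unfolding connected_components_def by auto
qed

text \<open>The adjacency matrix plus the identity is an all-ones block on each component.\<close>

lemma adjacency_set_vec_closed_nbhd:
  "adjacency_matrix G *v set_vec (closed_nbhd G u) + set_vec (closed_nbhd G u)
    = real (card (closed_nbhd G u)) *\<^sub>R set_vec (closed_nbhd G u)"
proof -
  let ?U = "closed_nbhd G u"
  have "(adjacency_matrix G *v set_vec ?U) $ v + set_vec ?U $ v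
      = real (card ?U) * set_vec ?U $ v" for v
  proof -
    have "(adjacency_matrix G *v set_vec ?U) $ v + set_vec ?U $ v
        = real (card (closed_nbhd G v \<inter> ?U))"
      unfolding sum_closed_nbhd[OF G, symmetric] set_vec_inner[symmetric] set_vec_inner_set_vec ..
    also have "\<dots> = real (card ?U) * set_vec ?U $ v"
    proof (cases "v \<in> ?U")
      case True
      then have "closed_nbhd G v = ?U" using mem_closed_nbhd_iff by blast
      then show ?thesis using True by (simp add: set_vec_nth)
    next
      case False
      then have "closed_nbhd G v \<inter> ?U = {}"
        using mem_closed_nbhd_iff closed_nbhd_disjoint by blast
      then show ?thesis using False by (simp add: set_vec_nth)
    qed
    finally show ?thesis .
  qed
  then show ?thesis by (simp add: vec_eq_iff)
qed

abbreviation component_size :: "'v \<Rightarrow> real" where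
  "component_size v \<equiv> real (card (closed_nbhd G v))"

context
  assumes card2: "2 \<le> CARD('v)" and compl: "\<not> disjoint_union_of_complete (complement_graph G)"
begin

text \<open>By \<open>adjacency_complement_graph\<close> this is the largest Rayleigh quotient on
  \<open>zero_sum\<close> of the adjacency matrix of \<open>G\<close> plus the identity, which makes
  it comparable with component sizes.\<close>

abbreviation compressed_max :: real where
  "compressed_max \<equiv> - compressed_min (complement_graph G)"

lemmas simple_complement = simple_complement_graph[OF G]

lemma compressed_max_gt_1: "1 < compressed_max"
  using compressed_min_less[OF simple_complement card2 compl] by simp

lemma compressed_space_complement:
  assumes "x \<in> compressed_space (complement_graph G)"
  obtains c where "\<And>v w. w \<in> closed_nbhd G v \<Longrightarrow> x $ w = x $ v"
    and "\<And>v. (component_size v - compressed_max) * x $ v = c"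
proof -
  have x: "x \<in> zero_sum" using assms by (simp add: rayleigh_space_def)
  obtain c where c: "\<forall>v. (adjacency_matrix (complement_graph G) *v x) $ v
      = compressed_min (complement_graph G) * x $ v + c"
    using compressed_space_nth[OF simple_complement card2 assms] by blast
  have "(adjacency_matrix G *v x) $ v + x $ v = compressed_max * x $ v + (- c)" for v
    using c[rule_format, of v] unfolding adjacency_complement_graph[OF G x] by simp
  moreover have "compressed_max \<noteq> 0" using compressed_max_gt_1 by linarith
  ultimately show ?thesis
    using component_sums_eq_imp[OF G duc, of compressed_max x "- c"] by (intro that[of "- c"]) blast+
qed

text \<open>
  The Rayleigh quotient of the difference of the uniform distributions on two components shows
  that \<open>compressed_max\<close> is at least the harmonic mean of their sizes.
\<close>

lemma harmonic_mean_le_compressed_max: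
  assumes "closed_nbhd G u \<noteq> closed_nbhd G w"
  shows "2 \<le> compressed_max * (1 / component_size u + 1 / component_size w)"
proof -
  let ?U = "set_vec (closed_nbhd G u)" and ?W = "set_vec (closed_nbhd G w)"
  define p q where "p = component_size u" and "q = component_size w"
  define y where "y = (1 / p) *\<^sub>R ?U - (1 / q) *\<^sub>R ?W"
  have pos: "p > 0" "q > 0" using card_closed_nbhd_pos by (simp_all add: p_def q_def)
  have inner: "?U \<bullet> ?U = p" "?W \<bullet> ?W = q" "?U \<bullet> ?W = 0" "?W \<bullet> ?U = 0"
    using closed_nbhd_disjoint[OF assms] by (simp_all add: set_vec_inner_set_vec p_def q_def Int_commute)
  have "vec 1 \<bullet> ?U = p" "vec 1 \<bullet> ?W = q"
    unfolding inner_commute[of "vec 1"] set_vec_inner p_def q_def by simp_all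
  then have y: "y \<in> zero_sum"
    unfolding zero_sum_eq y_def mem_Collect_eq inner_diff_right inner_scaleR_right using pos by simp
  have yy: "y \<bullet> y = 1 / p + 1 / q"
    using pos by (simp add: y_def inner_diff_left inner_diff_right inner)
  have "adjacency_matrix G *v y + y = ?U - ?W"
  proof -
    have "adjacency_matrix G *v y + y = (1 / p) *\<^sub>R (adjacency_matrix G *v ?U + ?U)
        - (1 / q) *\<^sub>R (adjacency_matrix G *v ?W + ?W)"
      by (simp add: y_def matrix_vector_mult_diff_distrib matrix_vector_mult_scaleR algebra_simps)
    then show ?thesis
      unfolding adjacency_set_vec_closed_nbhd p_def[symmetric] q_def[symmetric] using pos by simp
  qed
  moreover have "y \<bullet> (?U - ?W) = 2"
    using pos by (simp add: y_def inner_diff_left inner_diff_right inner)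
  ultimately have "y \<bullet> (adjacency_matrix G *v y) + y \<bullet> y = 2"
    by (metis inner_add_right)
  then have "y \<bullet> (adjacency_matrix (complement_graph G) *v y) = - 2"
    unfolding adjacency_complement_graph[OF G y] by (simp add: inner_diff_right)
  then have "- 2 \<ge> compressed_min (complement_graph G) * (y \<bullet> y)"
    using rayleigh_min_le[OF rayleigh_min_compressed_min[OF simple_complement card2] y] by simp
  then show ?thesis unfolding yy p_def q_def by simp
qed

abbreviation max_size :: nat where
  "max_size \<equiv> Max (range (\<lambda>v. card (closed_nbhd G v)))"

abbreviation max_components :: "'v set set" where
  "max_components \<equiv> {C \<in> range (closed_nbhd G). card C = max_size}"

lemma num_max_components_eq: "num_max_components G = card max_components"
  by (simp add: num_max_components_def connected_components_eq image_image)

lemma component_size_le: "card (closed_nbhd G v) \<le> max_size"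
  by (rule Max_ge) auto

lemma max_component_exists: obtains u where "card (closed_nbhd G u) = max_size"
proof -
  have "max_size \<in> range (\<lambda>v. card (closed_nbhd G v))" by (rule Max_in) auto
  then show ?thesis using that by (metis (no_types, lifting) rangeE)
qed

text \<open>Every component other than the largest has size below \<open>compressed_max\<close>. A
  minimizer that vanishes at a vertex \<open>u\<close> of the largest one has \<open>c = 0\<close>
  and hence vanishes everywhere, so the value at \<open>u\<close> determines it.\<close>

lemma dim_compressed_space_unique_max:
  assumes "card max_components < 2"
  shows "dim (compressed_space (complement_graph G)) = 1"
proof -
  let ?V = "compressed_space (complement_graph G)"
  obtain u where u: "card (closed_nbhd G u) = max_size" by (rule max_component_exists)
  have less: "component_size w < compressed_max" if w: "w \<notin> closed_nbhd G u" for w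
  proof (rule ccontr)
    assume "\<not> ?thesis"
    then have *: "compressed_max \<le> component_size w" by simp
    have ne: "closed_nbhd G u \<noteq> closed_nbhd G w" using w mem_closed_nbhd by blast
    have "card (closed_nbhd G w) \<noteq> max_size"
    proof
      assume "card (closed_nbhd G w) = max_size"
      then have "{closed_nbhd G u, closed_nbhd G w} \<subseteq> max_components" using u by auto
      then have "card {closed_nbhd G u, closed_nbhd G w} \<le> card max_components"
        by (intro card_mono) auto
      then show False using ne assms by simp
    qed
    then have "component_size w < component_size u"
      using component_size_le[of w] u by linarith
    moreover have "0 < component_size w" using card_closed_nbhd_pos[of w] by simp
    \<comment> \<open>The harmonic mean of two distinct sizes exceeds the smaller one.\<close>
    ultimately have "component_size w * (1 / component_size u + 1 / component_size w) < 2"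
      by (simp add: field_simps)
    moreover have "compressed_max * (1 / component_size u + 1 / component_size w)
        \<le> component_size w * (1 / component_size u + 1 / component_size w)"
      using * by (intro mult_right_mono) auto
    ultimately show False using harmonic_mean_le_compressed_max[OF ne] by linarith
  qed
  have "x = 0" if x: "x \<in> ?V" and xu: "x $ u = 0" for x
  proof -
    obtain c where const: "\<And>v w. w \<in> closed_nbhd G v \<Longrightarrow> x $ w = x $ v"
      and c: "\<And>v. (component_size v - compressed_max) * x $ v = c"
      using compressed_space_complement[OF x] by blast
    have "c = 0" using c[of u] xu by simp
    have "x $ w = 0" for w
    proof (cases "w \<in> closed_nbhd G u")
      case True
      then show ?thesis using const xu by simp
    next
      case False
      then show ?thesis using less[OF False] c[of w] \<open>c = 0\<close> by simp
    qed
    then show ?thesis by (simp add: vec_eq_iff)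
  qed
  then have "{x \<in> ?V. axis u 1 \<bullet> x = 0} \<subseteq> {0}" by (auto simp: inner_axis')
  then have "dim {x \<in> ?V. axis u 1 \<bullet> x = 0} = 0" by (simp only: dim_eq_0)
  then have "dim ?V \<le> 1"
    using dim_Int_hyperplane[OF subspace_compressed_space[OF simple_complement card2], of "axis u 1"]
    by linarith
  then show ?thesis using dim_compressed_space_pos[OF simple_complement card2] by linarith
qed

lemma dim_span_max_components: "dim (span (set_vec ` max_components)) = card max_components"
proof -
  have orth: "set_vec C \<bullet> set_vec D = 0" if "C \<in> max_components" "D \<in> max_components" "C \<noteq> D" for C D
  proof -
    have "C \<inter> D = {}" using that closed_nbhd_disjoint by auto
    then show ?thesis by (simp add: set_vec_inner_set_vec)
  qed
  have pos: "0 < set_vec C \<bullet> set_vec C" if "C \<in> max_components" for C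
  proof -
    obtain v where "C = closed_nbhd G v" using \<open>C \<in> max_components\<close> by blast
    then show ?thesis using card_closed_nbhd_pos[of v] by (simp add: set_vec_inner_set_vec)
  qed
  have "independent (set_vec ` max_components)"
  proof (rule pairwise_orthogonal_independent)
    show "pairwise orthogonal (set_vec ` max_components)"
      by (rule pairwise_imageI) (simp add: orthogonal_def orth)
    show "0 \<notin> set_vec ` max_components"
    proof
      assume "0 \<in> set_vec ` max_components"
      then show False
      proof (rule imageE)
        fix C assume "0 = set_vec C" "C \<in> max_components"
        then show False using pos[of C] by simp
      qed
    qed
  qed
  then have "dim (span (set_vec ` max_components)) = card (set_vec ` max_components)"
    by (rule dim_span_eq_card_independent)
  moreover have "inj_on set_vec max_components"
  proof (rule inj_onI, rule ccontr)
    fix C D assume "C \<in> max_components" "D \<in> max_components" "set_vec C = set_vec D" "C \<noteq> D"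
    then show False using orth[of C D] pos[of D] by simp
  qed
  then have "card (set_vec ` max_components) = card max_components" by (rule card_image)
  ultimately show ?thesis by (rule trans)
qed

text \<open>Two components of maximum size have that size as harmonic mean, which bounds from below.
  A larger value would make all factors \<open>compressed_max - component_size v\<close> positive
  and every minimizer zero.\<close>

lemma compressed_max_eq:
  assumes "2 \<le> card max_components"
  shows "compressed_max = real max_size"
proof (rule antisym)
  obtain C D where CD: "C \<in> max_components" "D \<in> max_components" "C \<noteq> D"
    using assms by (meson card_2_iff' ex_card subset_iff)
  then obtain u w where uw: "C = closed_nbhd G u" "D = closed_nbhd G w" by blast
  have "0 < max_size" using CD(1) uw card_closed_nbhd_pos[of u] by simp
  moreover have "2 \<le> compressed_max * (1 / real max_size + 1 / real max_size)"
    using harmonic_mean_le_compressed_max[of u w] CD uw by simp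
  ultimately show "real max_size \<le> compressed_max" by (simp add: field_simps)
  show "compressed_max \<le> real max_size"
  proof (rule ccontr)
    assume "\<not> ?thesis"
    then have less: "component_size v < compressed_max" for v
      using component_size_le[of v] by linarith
    obtain x where x: "x \<in> compressed_space (complement_graph G)" "x \<noteq> 0"
      by (rule compressed_space_nontrivial[OF simple_complement card2])
    obtain c where "\<And>v w. w \<in> closed_nbhd G v \<Longrightarrow> x $ w = x $ v"
      and c: "\<And>v. (component_size v - compressed_max) * x $ v = c"
      using compressed_space_complement[OF x(1)] by blast
    have "(compressed_max - component_size v) * x $ v = - c" for v
      using c[of v] by (simp add: algebra_simps)
    moreover have "x \<in> zero_sum" using x(1) by (simp add: rayleigh_space_def)
    ultimately have "x = 0"
      using less zero_sum_eq_0_of_sgn[of x "\<lambda>v. compressed_max - component_size v" "- c"] by simp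
    then show False using x(2) by simp
  qed
qed

lemma compressed_space_complement_eq:
  assumes "2 \<le> card max_components"
  shows "compressed_space (complement_graph G)
    = {x \<in> span (set_vec ` max_components). vec 1 \<bullet> x = 0}" (is "?V = ?F")
proof (intro set_eqI iffI)
  fix x assume x: "x \<in> ?V"
  then have z: "x \<in> zero_sum" by (simp add: rayleigh_space_def)
  obtain c where const: "\<And>v w. w \<in> closed_nbhd G v \<Longrightarrow> x $ w = x $ v"
    and c: "\<And>v. (component_size v - compressed_max) * x $ v = c"
    using compressed_space_complement[OF x] by blast
  obtain u where u: "card (closed_nbhd G u) = max_size" by (rule max_component_exists)
  \<comment> \<open>The factor at a largest component vanishes. With \<open>c = 0\<close>, the
    vector \<open>x\<close> is zero on all smaller components.\<close>
  have "c = 0" using c[of u] u compressed_max_eq[OF assms] by simp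
  \<comment> \<open>Any representative will do, because \<open>x\<close> is constant on
    components.\<close>
  define f where "f C = x $ (SOME v. v \<in> C)" for C
  have f: "f (closed_nbhd G v) = x $ v" for v
    unfolding f_def by (rule const, rule someI[of _ v], rule mem_closed_nbhd)
  have "x $ v = (\<Sum>C\<in>max_components. f C *\<^sub>R set_vec C) $ v" for v
  proof -
    have "(\<Sum>C\<in>max_components. f C *\<^sub>R set_vec C) $ v
        = (\<Sum>C\<in>max_components. if C = closed_nbhd G v then x $ v else 0)"
      unfolding sum_component
    proof (intro sum.cong refl)
      fix C assume "C \<in> max_components"
      then obtain w where w: "C = closed_nbhd G w" by blast
      show "(f C *\<^sub>R set_vec C) $ v = (if C = closed_nbhd G v then x $ v else 0)"
        using f[of v] mem_closed_nbhd_iff[of v w] w by (auto simp: set_vec_nth)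
    qed
    also have "\<dots> = (if closed_nbhd G v \<in> max_components then x $ v else 0)"
      by simp
    also have "\<dots> = x $ v"
    proof (cases "closed_nbhd G v \<in> max_components")
      case False
      then have "component_size v \<noteq> compressed_max" using compressed_max_eq[OF assms] by auto
      then show ?thesis using c[of v] \<open>c = 0\<close> by simp
    qed simp
    finally show ?thesis by simp
  qed
  then have "x = (\<Sum>C\<in>max_components. f C *\<^sub>R set_vec C)" unfolding vec_eq_iff by blast
  moreover have "(\<Sum>C\<in>max_components. f C *\<^sub>R set_vec C) \<in> span (set_vec ` max_components)"
    by (intro span_sum span_scale span_base imageI)
  ultimately show "x \<in> ?F" using z unfolding zero_sum_eq by simp
next
  fix x assume x: "x \<in> ?F"
  then have z: "x \<in> zero_sum" by (simp add: zero_sum_eq)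
  let ?E = "{x. adjacency_matrix G *v x + x = real max_size *\<^sub>R x}"
  have "subspace ?E"
  proof -
    have "?E = {x. adjacency_matrix G *v x = (real max_size - 1) *\<^sub>R x}"
      by (auto simp: scaleR_diff_left eq_diff_eq)
    then show ?thesis using subspace_eigenspace[of "adjacency_matrix G"] by simp
  qed
  moreover have "set_vec ` max_components \<subseteq> ?E" using adjacency_set_vec_closed_nbhd by auto
  ultimately have "span (set_vec ` max_components) \<subseteq> ?E" by (intro span_minimal)
  then have "adjacency_matrix G *v x + x = real max_size *\<^sub>R x" using x by blast
  then have "adjacency_matrix (complement_graph G) *v x = - (real max_size *\<^sub>R x)"
    unfolding adjacency_complement_graph[OF G z]
    by (metis add.commute minus_add_distrib uminus_add_conv_diff diff_conv_add_uminus)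
  then have "x \<bullet> (adjacency_matrix (complement_graph G) *v x) = - real max_size * (x \<bullet> x)"
    by simp
  moreover have "compressed_min (complement_graph G) = - real max_size"
    using compressed_max_eq[OF assms] by linarith
  ultimately show "x \<in> ?V" using z unfolding rayleigh_space_def by simp
qed

text \<open>With several largest components, the sum-zero condition removes one dimension from the
  span of their indicators; with a single one, the space is a line.\<close>

lemma dim_compressed_space_complement:
  "dim (compressed_space (complement_graph G)) + 1 = max (num_max_components G) 2"
proof (cases "card max_components < 2")
  case True
  then show ?thesis
    using dim_compressed_space_unique_max unfolding num_max_components_eq by simp
next
  case False
  then have r: "2 \<le> card max_components" by simp
  obtain u where u: "card (closed_nbhd G u) = max_size" by (rule max_component_exists)
  let ?u = "set_vec (closed_nbhd G u)"
  have "?u \<in> span (set_vec ` max_components)" using u by (intro span_base imageI) auto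
  moreover have "vec 1 \<bullet> ?u \<noteq> 0"
    unfolding inner_commute[of "vec 1"] set_vec_inner using mem_closed_nbhd[of u] by auto
  ultimately have "dim (span (set_vec ` max_components))
      = dim (compressed_space (complement_graph G)) + 1"
    unfolding compressed_space_complement_eq[OF r] by (intro dim_Int_hyperplane_eq) auto
  then show ?thesis unfolding dim_span_max_components num_max_components_eq using r by simp
qed

end

end

section \<open>Assembling the two cases\<close>

lemma not_disjoint_union_of_complete_complement:
  assumes "simple_graph G" "disjoint_union_of_complete G" "\<not> complete_graph G" "\<not> empty_graph G"
  shows "\<not> disjoint_union_of_complete (complement_graph G)"
proof -
  have sym: "G s t \<longleftrightarrow> G t s" and irr: "\<not> G s s" for s t
    using assms(1) by (auto simp: simple_graph_def irreflp_def dest: sympD)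
  have trans: "G u w" if "G u v" "G v w" "u \<noteq> w" for u v w
    using that assms(2) disjoint_union_of_complete_iff[OF assms(1)] by blast
  obtain u v where uv: "G u v" using assms(4) by (auto simp: empty_graph_def)
  \<comment> \<open>If \<open>u\<close> were adjacent to all other vertices, transitivity would make
    \<open>G\<close> complete. In the complement, \<open>u\<close>, \<open>w\<close>,
    \<open>v\<close> then form an induced path.\<close>
  obtain w where w: "w \<noteq> u" "\<not> G u w"
    using assms(3) trans sym unfolding complete_graph_def by metis
  have "w \<noteq> v" "\<not> G w v" using uv w trans[of u v w] sym by metis+
  then have "complement_graph G u w" "complement_graph G w v" "u \<noteq> v" "\<not> complement_graph G u v"
    using uv w irr unfolding complement_graph_def by auto
  then show ?thesis
    unfolding disjoint_union_of_complete_iff[OF simple_complement_graph[OF assms(1)]] by blast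
qed

text \<open>\<open>H\<close> itself has excess 0, so the whole drop in dimension comes from its
  complement. The maximum of the excesses is symmetric, so either graph may play the role of
  \<open>H\<close>.\<close>

lemma Rep_disjoint_union_of_complete:
  fixes G H :: "'v::finite graph"
  assumes "simple_graph G" "2 \<le> CARD('v)" "\<not> complete_graph G" "\<not> empty_graph G"
    and H: "H = G \<or> H = complement_graph G" "disjoint_union_of_complete H"
  shows "int (Rep G) = int CARD('v) - max (int (num_max_components H)) 2"
proof -
  have simple: "simple_graph H" using H assms(1) simple_complement_graph by blast
  have GH: "complement_graph H = G \<or> H = G" "max (excess G) (excess (complement_graph G))
      = max (excess H) (excess (complement_graph H))"
    using H complement_complement_graph[OF assms(1)] by (auto simp: max.commute)
  have "\<not> complete_graph H" "\<not> empty_graph H"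
    using H assms(3,4) by (auto simp: complete_graph_def empty_graph_def complement_graph_def)
      (metis assms(1) irreflp_def simple_graph_def)
  then have n: "\<not> disjoint_union_of_complete (complement_graph H)"
    by (rule not_disjoint_union_of_complete_complement[OF simple H(2)])
  have "int (Rep G) = int CARD('v) - 1 - int (dim (compressed_space (complement_graph H)))"
    unfolding Rep_eq_excess[OF assms(1,2)] GH(2) using H(2) n by (simp add: excess_def)
  moreover have "int (dim (compressed_space (complement_graph H))) + 1
      = max (int (num_max_components H)) 2"
    using dim_compressed_space_complement[OF simple H(2) assms(2) n] by linarith
  ultimately show ?thesis by linarith
qed

lemma regular_complement_graph:
  fixes G :: "'v::finite graph"
  assumes "simple_graph G" "regular G"
  shows "regular (complement_graph G)"
proof -
  have "vertex_degree (complement_graph G) u = CARD('v) - 1 - vertex_degree G u" for u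
  proof -
    have "{v. complement_graph G u v} = UNIV - insert u {v. G u v}" "u \<notin> {v. G u v}"
      using assms(1) by (auto simp: complement_graph_def simple_graph_def irreflp_def)
    then show ?thesis by (simp add: vertex_degree_def card_Diff_subset)
  qed
  then show ?thesis using assms(2) unfolding regular_def by metis
qed

text \<open>The formulas are stated over \<open>int\<close>, where subtraction is not
  truncated.\<close>

theorem theorem1p1:
  fixes G :: "'v::finite graph" and n :: nat
  assumes "simple_graph G"
    and "CARD('v) = n"
    and "\<not> complete_graph G"
    and "\<not> empty_graph G"
  shows "(\<forall>H\<in>{G, complement_graph G}. disjoint_union_of_complete H \<longrightarrow>
            int (Rep G) = int n - max (int (num_max_components H)) 2)
    \<and> (\<not> disjoint_union_of_complete G \<and> \<not> disjoint_union_of_complete (complement_graph G) \<longrightarrow>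
        (let A = adjacency_matrix G;
             A' = adjacency_matrix (complement_graph G);
             m1 = int (eigenvalue_multiplicity A (smallest_eigenvalue A));
             m2 = int (eigenvalue_multiplicity A (second_smallest_eigenvalue A));
             m1' = int (eigenvalue_multiplicity A' (smallest_eigenvalue A'));
             m2' = int (eigenvalue_multiplicity A' (second_smallest_eigenvalue A'))
         in int n - 1 - Max {m1, m1', m2 + 1, m2' + 1} \<le> int (Rep G)
          \<and> int (Rep G) \<le> int n - Max {m1, m1', 2}
          \<and> (regular G \<longrightarrow> int (Rep G) = int n - 1 - max m1 m1')))"
proof (intro conjI impI)
  obtain u v where "G u v" using assms(4) by (auto simp: empty_graph_def)
  then have "u \<noteq> v" using assms(1) by (auto simp: simple_graph_def irreflp_def)
  then have card2: "2 \<le> CARD('v)" using card_mono[of UNIV "{u, v}"] by simp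
  show "\<forall>H\<in>{G, complement_graph G}. disjoint_union_of_complete H \<longrightarrow>
      int (Rep G) = int n - max (int (num_max_components H)) 2"
    using Rep_disjoint_union_of_complete[OF assms(1) card2 assms(3,4)] unfolding assms(2) by blast
  assume duc: "\<not> disjoint_union_of_complete G \<and> \<not> disjoint_union_of_complete (complement_graph G)"
  note G = assms(1) card2 and G' = simple_complement_graph[OF assms(1)] card2
  have Rep: "int (Rep G) = int n - 1
      - max (int (dim (compressed_space G))) (int (dim (compressed_space (complement_graph G))))"
    using Rep_eq_excess[OF G] duc by (simp add: excess_def assms(2))
  define a a' m1 m1' m2 m2' where defs: "a = dim (compressed_space G)"
    "a' = dim (compressed_space (complement_graph G))"
    "m1 = eigenvalue_multiplicity (adjacency_matrix G) (smallest_eigenvalue (adjacency_matrix G))"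
    "m1' = eigenvalue_multiplicity (adjacency_matrix (complement_graph G))
      (smallest_eigenvalue (adjacency_matrix (complement_graph G)))"
    "m2 = eigenvalue_multiplicity (adjacency_matrix G)
      (second_smallest_eigenvalue (adjacency_matrix G))"
    "m2' = eigenvalue_multiplicity (adjacency_matrix (complement_graph G))
      (second_smallest_eigenvalue (adjacency_matrix (complement_graph G)))"
  have "int a \<le> max (int m1) (int m2 + 1)" "int a' \<le> max (int m1') (int m2' + 1)"
    using dim_compressed_space_le[OF G] dim_compressed_space_le[OF G'] unfolding defs by linarith+
  then have "int a \<le> Max {int m1, int m1', int m2 + 1, int m2' + 1}"
    "int a' \<le> Max {int m1, int m1', int m2 + 1, int m2' + 1}"
    by (auto simp: le_max_iff_disj)
  then have lower: "max (int a) (int a') \<le> Max {int m1, int m1', int m2 + 1, int m2' + 1}"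
    by (rule max.boundedI)
  \<comment> \<open>A nonzero minimizer always exists, so \<open>a\<close> is at least 1; this is
    the source of the 2 in the upper bound.\<close>
  have "1 \<le> a" "m1 \<le> a + 1" "m1' \<le> a' + 1"
    using dim_compressed_space_pos[OF G] dim_compressed_space_ge[OF G] dim_compressed_space_ge[OF G']
    unfolding defs by simp_all
  then have "int m1 \<le> max (int a) (int a') + 1" "int m1' \<le> max (int a) (int a') + 1"
    "2 \<le> max (int a) (int a') + 1" by linarith+
  then have upper: "Max {int m1, int m1', 2} \<le> max (int a) (int a') + 1" by simp
  have regular: "a = m1 \<and> a' = m1'" if "regular G"
    using dim_compressed_space_regular[OF G that]
      dim_compressed_space_regular[OF G' regular_complement_graph[OF assms(1) that]] duc
    unfolding defs by blast
  show "let A = adjacency_matrix G;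
             A' = adjacency_matrix (complement_graph G);
             m1 = int (eigenvalue_multiplicity A (smallest_eigenvalue A));
             m2 = int (eigenvalue_multiplicity A (second_smallest_eigenvalue A));
             m1' = int (eigenvalue_multiplicity A' (smallest_eigenvalue A'));
             m2' = int (eigenvalue_multiplicity A' (second_smallest_eigenvalue A'))
         in int n - 1 - Max {m1, m1', m2 + 1, m2' + 1} \<le> int (Rep G)
          \<and> int (Rep G) \<le> int n - Max {m1, m1', 2}
          \<and> (regular G \<longrightarrow> int (Rep G) = int n - 1 - max m1 m1')"
    unfolding Let_def Rep defs[symmetric]
    by (intro conjI impI) (use lower in linarith, use upper in linarith, use regular in simp)
qed

end
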